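(* Let $-\infty<a<b<\infty$, let $n\ge 0$ be an integer, and let $g_0,\dots,g_{n+1}\colon[a,b]\to\mathbb{R}$ be continuous functions. Suppose that $(g_0,\dots,g_{n+1})$ is an $M_+$-system on $[a,b]$ or, more generally, that each of the sequences $(g_0,\dots,g_n)$ and $(g_0,\dots,g_{n+1})$ is a $T_+$-system on $[a,b]$. Let $\mathbf{c}=(c_0,\dots,c_n)\in\mathbb{R}^{n+1}$ be such that the set $$M_{\mathbf{c}}:=\Big\{\mu\in M\colon \int_{[a,b]} g_i\,\mathrm{d}\mu=c_i\ \text{ for all } i\in\{0,\dots,n\}\Big\}$$ is nonempty, where $M$ is the set of all (nonnegative) Borel measures on $[a,b]$. Let $m:=\lfloor\frac{n+1}{2}\rfloor$. Then: (I) The maximum (respectively, the minimum) of $\int_{[a,b]} g_{n+1}\,\mathrm{d}\mu$ over all $\mu\in M_{\mathbf{c}}$ is attained at a unique measure $\mu_{\max}$ (respectively, $\mu_{\min}$) in $M_{\mathbf{c}}$. Moreover, for given $g_0,\dots,g_n$ and $\mathbf{c}$, the measures $\mu_{\max}$ and $\mu_{\min}$ do not depend on the choice of the continuous function $g_{n+1}$, as long as $g_{n+1}$ is such that $(g_0,\dots,g_{n+1})$ is a $T_+$-system on $[a,b]$. (II) There exist subsets $X_{\max}$ and $X_{\min}$ of $[a,b]$ such that $X_{\max}\supseteq\operatorname{supp}\mu_{\max}$, $X_{\min}\supseteq\operatorname{supp}\mu_{\min}$, and (a) if $n=2m$, then $\operatorname{card}X_{\max}=\operatorname{card}X_{\min}=m+1$,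 $b\in X_{\max}$, and $a\in X_{\min}$; (b) if $n=2m-1$, then $\operatorname{card}X_{\max}=m+1$, $\operatorname{card}X_{\min}=m$, and $X_{\max}\supseteq\{a,b\}$.
   Context: For an integer $k\ge 0$, a sequence $(g_0,\dots,g_k)$ of continuous real-valued functions on $[a,b]$ is a $T_+$-system on $[a,b]$ if $\det\big(g_i(x_j)\big)_{i,j=0}^k>0$ for all $(x_0,\dots,x_k)$ with $a\le x_0<\dots<x_k\le b$. The sequence $(g_0,\dots,g_k)$ is an $M_+$-system on $[a,b]$ if $(g_0,\dots,g_l)$ is a $T_+$-system on $[a,b]$ for each $l\in\{0,\dots,k\}$. $\operatorname{supp}\mu$ denotes the support set of the measure $\mu$, and $\operatorname{card}$ denotes cardinality. The zero measure belongs to $M$ and has empty support. *)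

theory Defs
  imports "HOL-Analysis.Analysis" "Jordan_Normal_Form.Determinant"
begin

text \<open>A sequence \<open>(g\<^sub>0, \<dots>, g\<^sub>k)\<close> of functions on \<open>[a, b]\<close> is given by a family
  \<open>g :: nat \<Rightarrow> real \<Rightarrow> real\<close> and its last index \<open>k\<close>; only the values \<open>g i t\<close> with \<open>i \<le> k\<close> and
  \<open>t \<in> {a..b}\<close> matter. Determinants are those of Jordan_Normal_Form, since \<open>k\<close> is a term.\<close>

definition T_plus_system :: "real \<Rightarrow> real \<Rightarrow> nat \<Rightarrow> (nat \<Rightarrow> real \<Rightarrow> real) \<Rightarrow> bool" where
  "T_plus_system a b k g \<longleftrightarrow>
     (\<forall>i\<le>k. continuous_on {a..b} (g i)) \<and>
     (\<forall>x :: nat \<Rightarrow> real. a \<le> x 0 \<and> strict_mono_on {..k} x \<and> x k \<le> b \<longrightarrow>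
        Determinant.det (Matrix.mat (k + 1) (k + 1) (\<lambda>(i, j). g i (x j))) > 0)"

definition M_plus_system :: "real \<Rightarrow> real \<Rightarrow> nat \<Rightarrow> (nat \<Rightarrow> real \<Rightarrow> real) \<Rightarrow> bool" where
  "M_plus_system a b k g \<longleftrightarrow> (\<forall>l\<le>k. T_plus_system a b l g)"

text \<open>Measures are not required to be finite here.\<close>

definition borel_measures_on :: "real \<Rightarrow> real \<Rightarrow> real measure set" where
  "borel_measures_on a b = {\<mu>. sets \<mu> = sets (restrict_space borel {a..b})}"

text \<open>The predicate \<open>has_bochner_integral\<close> includes integrability, which the equation
  \<open>integral\<^sup>L \<mu> (g i) = c i\<close> would not, as the integral of a non-integrable function is \<open>0\<close>.\<close>

definition moment_measures ::
    "real \<Rightarrow> real \<Rightarrow> nat \<Rightarrow> (nat \<Rightarrow> real \<Rightarrow> real) \<Rightarrow> (nat \<Rightarrow> real) \<Rightarrow> real measure set" where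
  "moment_measures a b n g c =
     {\<mu> \<in> borel_measures_on a b. \<forall>i\<le>n. has_bochner_integral \<mu> (g i) (c i)}"

definition measure_support :: "'a::topological_space measure \<Rightarrow> 'a set" where
  "measure_support \<mu> =
     {x \<in> space \<mu>. \<forall>U. open U \<and> x \<in> U \<longrightarrow> emeasure \<mu> (U \<inter> space \<mu>) > 0}"

text \<open>The integrability conjuncts say that the integral being optimized is defined on all of \<open>N\<close>.\<close>

definition unique_maximizer ::
    "real measure set \<Rightarrow> (real \<Rightarrow> real) \<Rightarrow> real measure \<Rightarrow> bool" where
  "unique_maximizer N h \<mu> \<longleftrightarrow>
     (\<forall>\<nu>\<in>N. integrable \<nu> h) \<and>
     (\<forall>\<nu>. is_arg_max (\<lambda>\<rho>. integral\<^sup>L \<rho> h) (\<lambda>\<rho>. \<rho> \<in> N) \<nu> \<longleftrightarrow> \<nu> = \<mu>)"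

definition unique_minimizer ::
    "real measure set \<Rightarrow> (real \<Rightarrow> real) \<Rightarrow> real measure \<Rightarrow> bool" where
  "unique_minimizer N h \<mu> \<longleftrightarrow>
     (\<forall>\<nu>\<in>N. integrable \<nu> h) \<and>
     (\<forall>\<nu>. is_arg_min (\<lambda>\<rho>. integral\<^sup>L \<rho> h) (\<lambda>\<rho>. \<rho> \<in> N) \<nu> \<longleftrightarrow> \<nu> = \<mu>)"

end

theory Submission
  imports Defs "HOL-Probability.Helly_Selection" "HOL-Probability.Giry_Monad"
begin

text \<open>
Let \<open>E\<close> be a set of endpoints of \<open>[a, b]\<close> and \<open>q\<close> a number with \<open>2 q + card E = n + 1\<close>. For the
maximum, \<open>E = {b}\<close> if \<open>n\<close> is even and \<open>E = {a, b}\<close> if \<open>n\<close> is odd; for the minimum, \<open>E = {a}\<close> if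
\<open>n\<close> is even and \<open>E = {}\<close> if \<open>n\<close> is odd. The proof shows that the extremal measure is the only
measure with the given moments whose support has at most \<open>q\<close> points outside \<open>E\<close>.

\<^item> There is at most one such measure (\<open>principal_measure_unique\<close>): two of them live on at most
  \<open>2 q + card E = n + 1\<close> common points, and \<open>n + 1\<close> moments determine the masses at \<open>n + 1\<close> points.

\<^item> An extremal measure is of this kind (\<open>extremal_support\<close>). If its support has \<open>q + 1\<close> points outside
  \<open>E\<close>, these can be interlaced with \<open>q + card E\<close> further points of \<open>[a, b]\<close>. On the resulting
  \<open>n + 2\<close> points there is a signed measure with alternating signs that annihilates \<open>g\<^sub>0, \<dots>, g\<^sub>n\<close> but
  not \<open>g\<^sub>n\<^sub>+\<^sub>1\<close>, and it is negative only at the support points. A small multiple of it can be added,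
  which improves the integral of \<open>g\<^sub>n\<^sub>+\<^sub>1\<close>. The support points need not be atoms, so mass is removed in
  small neighbourhoods; the \<open>T\<^sub>+\<close> determinants remain positive when point evaluations are replaced by
  integrals over separated sets (\<open>det_moments_pos\<close>).

\<^item> Extremal measures exist (\<open>moment_measures_attain_extrema\<close>), because the class of measures with the
  given moments is weakly sequentially compact. The total masses in it are bounded since a nonzero
  measure cannot have all its moments equal to zero (\<open>zero_moments_imp_zero\<close>).

The condition on the support does not mention \<open>g\<^sub>n\<^sub>+\<^sub>1\<close>, so neither does the extremal measure depend on
it. Adding points to the at most \<open>q + card E\<close> points of the support and \<open>E\<close> gives \<open>X\<^sub>m\<^sub>a\<^sub>x\<close> and \<open>X\<^sub>m\<^sub>i\<^sub>n\<close>.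
\<close>

section \<open>Moments of measures on separated sets\<close>

lemma borel_measures_onD:
  assumes "\<mu> \<in> borel_measures_on a b"
  shows "sets \<mu> = sets (restrict_space borel {a..b})" "space \<mu> = {a..b}"
  using assms sets_eq_imp_space_eq[of \<mu> "restrict_space borel {a..b}"]
  by (auto simp: borel_measures_on_def space_restrict_space)

lemma borel_measures_on_measurable:
  assumes "\<mu> \<in> borel_measures_on a b" "continuous_on {a..b} f"
  shows "f \<in> borel_measurable \<mu>"
proof -
  have "f \<in> borel_measurable (restrict_space borel {a..b})"
    using assms(2) by (rule borel_measurable_continuous_on_restrict)
  then show ?thesis
    using measurable_cong_sets[OF borel_measures_onD(1)[OF assms(1)] refl] by blast
qed

lemma borel_measures_on_sets:
  assumes "\<mu> \<in> borel_measures_on a b"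
  shows "A \<in> sets \<mu> \<longleftrightarrow> A \<in> sets borel \<and> A \<subseteq> {a..b}"
  using borel_measures_onD[OF assms] by (auto simp: sets_restrict_space_iff)

lemma borel_measures_on_integrable:
  fixes f :: "real \<Rightarrow> real"
  assumes "\<mu> \<in> borel_measures_on a b" "finite_measure \<mu>" "continuous_on {a..b} f"
  shows "integrable \<mu> f"
proof -
  have "bounded (f ` {a..b})"
    using compact_continuous_image[OF assms(3)] compact_imp_bounded by blast
  then obtain B where "\<forall>x\<in>{a..b}. norm (f x) \<le> B"
    by (auto simp: bounded_iff)
  then show ?thesis
    using borel_measures_onD[OF assms(1)] borel_measures_on_measurable[OF assms(1,3)]
    by (intro finite_measure.integrable_const_bound[OF assms(2)]) (auto intro!: AE_I2)
qed

lemma T_plus_systemD: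
  assumes "T_plus_system a b k g"
  shows "\<And>i. i \<le> k \<Longrightarrow> continuous_on {a..b} (g i)"
    and "\<And>x. strict_mono_on {..k} x \<Longrightarrow> x ` {..k} \<subseteq> {a..b} \<Longrightarrow>
      Determinant.det (Matrix.mat (k + 1) (k + 1) (\<lambda>(i, j). g i (x j))) > 0"
  using assms by (auto simp: T_plus_system_def image_subset_iff)

lemma cofactor_cong_column:
  assumes "\<And>i' j'. i' < N \<Longrightarrow> j' < N \<Longrightarrow> j' \<noteq> j \<Longrightarrow> A i' j' = B i' j'" and "i < N" "j < N"
  shows "cofactor (Matrix.mat N N (\<lambda>(i, j). A i j)) i j =
    cofactor (Matrix.mat N N (\<lambda>(i, j). B i j)) i j"
  using assms unfolding cofactor_def mat_delete_def
  by (intro arg_cong2[where f="(*)"] refl arg_cong[where f=Determinant.det] eq_matI) auto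

text \<open>The determinant is linear in each column, so a column of moments of \<open>\<nu>\<^sub>j\<close> makes it the
\<open>\<nu>\<^sub>j\<close>-average of determinants in which that column is a point evaluation. Hence positivity passes
from points \<open>x\<^sub>0 < \<dots> < x\<^sub>k\<close> to measures that sit on sets \<open>J\<^sub>0 < \<dots> < J\<^sub>k\<close>. In this form the
\<open>T\<^sub>+\<close> condition applies to measures without atoms.\<close>

lemma det_moments_pos:
  assumes T: "T_plus_system a b k g"
    and \<nu>: "\<And>j. j \<le> k \<Longrightarrow> \<nu> j \<in> borel_measures_on a b" "\<And>j. j \<le> k \<Longrightarrow> finite_measure (\<nu> j)"
    and conc: "\<And>j. j \<le> k \<Longrightarrow> AE t in \<nu> j. t \<in> J j"
    and nonzero: "\<And>j. j \<le> k \<Longrightarrow> emeasure (\<nu> j) {a..b} \<noteq> 0"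
    and sep: "\<And>i j s t. i < j \<Longrightarrow> j \<le> k \<Longrightarrow> s \<in> J i \<Longrightarrow> t \<in> J j \<Longrightarrow> s < t"
    and J: "\<And>j. j \<le> k \<Longrightarrow> J j \<subseteq> {a..b}"
  shows "Determinant.det (Matrix.mat (k + 1) (k + 1) (\<lambda>(i, j). integral\<^sup>L (\<nu> j) (g i))) > 0"
proof -
  \<comment> \<open>The first \<open>p\<close> columns are already integrated; the others are still evaluated at \<open>x\<close>.\<close>
  define A where "A p x = Matrix.mat (k + 1) (k + 1)
      (\<lambda>(i, j). if j < p then integral\<^sup>L (\<nu> j) (g i) else g i (x j))" for p :: nat and x
  have "Determinant.det (A p x) > 0" if "p \<le> k + 1" "\<And>j. p \<le> j \<Longrightarrow> j \<le> k \<Longrightarrow> x j \<in> J j" for p x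
    using that
  proof (induction p arbitrary: x)
    case 0
    have "strict_mono_on {..k} x"
      using sep 0 by (auto simp: strict_mono_on_def)
    moreover have "x ` {..k} \<subseteq> {a..b}"
      using 0 J by blast
    ultimately show ?case
      using T_plus_systemD(2)[OF T] by (simp add: A_def)
  next
    case (Suc p)
    then have p: "p \<le> k" by simp
    let ?C = "\<lambda>i. cofactor (A (Suc p) x) i p"
    define f where "f t = Determinant.det (A p (x(p := t)))" for t
    have cof: "cofactor (A p (x(p := t))) i p = ?C i" if "i < k + 1" for i t
      unfolding A_def using p that by (intro cofactor_cong_column) auto
    have f_eq: "f t = (\<Sum>i<k+1. g i t * ?C i)" for t
    proof -
      have "f t = (\<Sum>i<k+1. A p (x(p := t)) $$ (i, p) * cofactor (A p (x(p := t))) i p)"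
        unfolding f_def by (rule laplace_expansion_column) (use p in \<open>auto simp: A_def\<close>)
      also have "\<dots> = (\<Sum>i<k+1. g i t * ?C i)"
        by (intro sum.cong refl arg_cong2[where f="(*)"] cof) (use p in \<open>auto simp: A_def\<close>)
      finally show ?thesis .
    qed
    have int_g: "integrable (\<nu> p) (g i)" if "i < k + 1" for i
      using borel_measures_on_integrable[OF \<nu>(1,2)[OF p]] T_plus_systemD(1)[OF T] that by simp
    have int_f: "integrable (\<nu> p) f"
      unfolding f_eq using int_g
      by (intro Bochner_Integration.integrable_sum integrable_mult_left) auto
    have "Determinant.det (A (Suc p) x) = (\<Sum>i<k+1. A (Suc p) x $$ (i, p) * ?C i)"
      by (rule laplace_expansion_column) (use p in \<open>auto simp: A_def\<close>)
    also have "\<dots> = (\<Sum>i<k+1. integral\<^sup>L (\<nu> p) (g i) * ?C i)"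
      by (intro sum.cong refl arg_cong2[where f="(*)"]) (use p in \<open>auto simp: A_def\<close>)
    also have "\<dots> = integral\<^sup>L (\<nu> p) f"
      unfolding f_eq using int_g by (subst Bochner_Integration.integral_sum) auto
    finally have det_eq: "Determinant.det (A (Suc p) x) = integral\<^sup>L (\<nu> p) f" .
    have f_pos: "f t > 0" if "t \<in> J p" for t
      unfolding f_def using Suc.prems that p by (intro Suc.IH) auto
    have AE_pos: "AE t in \<nu> p. f t > 0"
      using conc[OF p] f_pos by auto
    then have "AE t in \<nu> p. f t \<ge> 0"
      by (auto elim!: eventually_mono)
    moreover have "integral\<^sup>L (\<nu> p) f \<noteq> 0"
    proof
      assume "integral\<^sup>L (\<nu> p) f = 0"
      then have "AE t in \<nu> p. f t = 0"
        using integral_nonneg_eq_0_iff_AE[OF int_f \<open>AE t in \<nu> p. f t \<ge> 0\<close>] by simp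
      with AE_pos have "AE t in \<nu> p. False"
        by eventually_elim simp
      then show False
        using nonzero[OF p] borel_measures_onD(2)[OF \<nu>(1)[OF p]]
        by (simp add: eventually_False trivial_limit_def[symmetric] ae_filter_eq_bot_iff)
    qed
    ultimately show ?case
      using integral_nonneg_AE[where M="\<nu> p" and f=f] det_eq by fastforce
  qed
  from this[of "k + 1" undefined] have "Determinant.det (A (k + 1) undefined) > 0"
    by simp
  moreover have "A (k + 1) undefined = Matrix.mat (k + 1) (k + 1) (\<lambda>(i, j). integral\<^sup>L (\<nu> j) (g i))"
    unfolding A_def by (rule cong_mat) auto
  ultimately show ?thesis by simp
qed

text \<open>The coefficients are the cofactors of the last row of the \<open>(n+2) \<times> (n+2)\<close> moment matrix. Expanding
along that row gives the determinant, which is positive; putting another row in its place gives a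
matrix with two equal rows. Each cofactor is a signed moment determinant of \<open>(g\<^sub>0, \<dots>, g\<^sub>n)\<close> for the
remaining \<open>n+1\<close> measures, so its sign is known.\<close>

lemma alternating_coefficients:
  assumes Tn: "T_plus_system a b n g" and Tn1: "T_plus_system a b (n + 1) g"
    and \<nu>: "\<And>j. j \<le> n + 1 \<Longrightarrow> \<nu> j \<in> borel_measures_on a b" "\<And>j. j \<le> n + 1 \<Longrightarrow> finite_measure (\<nu> j)"
    and conc: "\<And>j. j \<le> n + 1 \<Longrightarrow> AE t in \<nu> j. t \<in> J j"
    and nonzero: "\<And>j. j \<le> n + 1 \<Longrightarrow> emeasure (\<nu> j) {a..b} \<noteq> 0"
    and sep: "\<And>i j s t. i < j \<Longrightarrow> j \<le> n + 1 \<Longrightarrow> s \<in> J i \<Longrightarrow> t \<in> J j \<Longrightarrow> s < t"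
    and J: "\<And>j. j \<le> n + 1 \<Longrightarrow> J j \<subseteq> {a..b}"
  obtains l :: "nat \<Rightarrow> real" where
    "\<And>j. j \<le> n + 1 \<Longrightarrow> (-1) ^ (n + 1 + j) * l j > 0"
    "\<And>i. i \<le> n \<Longrightarrow> (\<Sum>j\<le>n+1. l j * integral\<^sup>L (\<nu> j) (g i)) = 0"
    "(\<Sum>j\<le>n+1. l j * integral\<^sup>L (\<nu> j) (g (n + 1))) > 0"
proof -
  define A where "A = Matrix.mat (n + 2) (n + 2) (\<lambda>(i, j). integral\<^sup>L (\<nu> j) (g i))"
  define l where "l j = cofactor A (n + 1) j" for j
  have A: "A \<in> carrier_mat (n + 2) (n + 2)" by (simp add: A_def)
  have detA: "Determinant.det A > 0"
    using det_moments_pos[OF Tn1 \<nu> conc nonzero sep J] by (simp add: A_def numeral_2_eq_2)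
  have ip: "(\<Sum>j\<le>n+1. l j * integral\<^sup>L (\<nu> j) (g i)) = (if i = n + 1 then Determinant.det A else 0)"
    if "i \<le> n + 1" for i
  proof -
    have "(\<Sum>j\<le>n+1. l j * integral\<^sup>L (\<nu> j) (g i)) = (A * adj_mat A) $$ (i, n + 1)"
      using that A
      by (auto simp: scalar_prod_def adj_mat_def l_def A_def atLeast0LessThan lessThan_Suc_atMost
          intro!: sum.cong)
    also have "\<dots> = (if i = n + 1 then Determinant.det A else 0)"
      using that by (simp add: adj_mat(2)[OF A])
    finally show ?thesis .
  qed
  have "(-1) ^ (n + 1 + j) * l j > 0" if "j \<le> n + 1" for j
  proof -
    \<comment> \<open>\<open>s\<close> enumerates the columns that remain when column \<open>j\<close> is deleted.\<close>
    define s where "s i = (if i < j then i else Suc i)" for i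
    have s: "i < i' \<Longrightarrow> s i < s i'" "i \<le> n \<Longrightarrow> s i \<le> n + 1" for i i'
      by (auto simp: s_def)
    have "mat_delete A (n + 1) j = Matrix.mat (n + 1) (n + 1) (\<lambda>(i, j). integral\<^sup>L (\<nu> (s j)) (g i))"
      using that by (auto simp: mat_delete_def A_def s_def intro!: eq_matI)
    moreover have "Determinant.det \<dots> > 0"
    proof (rule det_moments_pos[OF Tn, where J="J \<circ> s"])
      show "t < u" if "i < i'" "i' \<le> n" "t \<in> (J \<circ> s) i" "u \<in> (J \<circ> s) i'" for i i' t u
        using sep[OF s(1)[OF that(1)] s(2)[OF that(2)]] that by simp
    qed (use s(2) J in \<open>auto intro: \<nu> conc simp: nonzero\<close>)
    ultimately have "Determinant.det (mat_delete A (n + 1) j) > 0" by simp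
    then show ?thesis
      by (simp add: l_def cofactor_def power_add[symmetric] mult.assoc[symmetric])
  qed
  with ip[of "n + 1"] ip detA show ?thesis
    by (intro that[of l]) auto
qed

section \<open>Supports and vanishing moments\<close>

lemma moment_measuresD:
  assumes "\<mu> \<in> moment_measures a b n g c"
  shows "\<mu> \<in> borel_measures_on a b"
    and "\<And>i. i \<le> n \<Longrightarrow> integrable \<mu> (g i)" "\<And>i. i \<le> n \<Longrightarrow> integral\<^sup>L \<mu> (g i) = c i"
  using assms by (auto simp: moment_measures_def has_bochner_integral_iff)

lemma ex_strict_mono_enumeration:
  fixes X :: "'a::linorder set"
  assumes "finite X" "card X = k + 1"
  obtains x where "strict_mono_on {..k} x" "x ` {..k} = X"
proof -
  define xs where "xs = sorted_list_of_set X"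
  have len: "length xs = k + 1" and set: "set xs = X"
    using assms by (simp_all add: xs_def)
  have "sorted_wrt (<) xs"
    unfolding xs_def by (rule strict_sorted_list_of_set)
  then have "strict_mono_on {..k} (nth xs)"
    using len by (auto simp: strict_mono_on_def sorted_wrt_iff_nth_less)
  moreover have "nth xs ` {..k} = X"
    using len unfolding set[symmetric] set_conv_nth
    by (auto simp: less_Suc_eq_le)
  ultimately show ?thesis by (rule that)
qed

lemma ex_superset_card_interval:
  fixes a b :: real
  assumes "a < b" "finite F" "F \<subseteq> {a..b}" "card F \<le> N"
  obtains X where "F \<subseteq> X" "X \<subseteq> {a..b}" "finite X" "card X = N"
proof -
  have "infinite ({a..b} - F)"
    using assms by (simp add: Diff_infinite_finite infinite_Icc)
  then obtain Y where Y: "finite Y" "card Y = N - card F" "Y \<subseteq> {a..b} - F"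
    using infinite_arbitrarily_large by blast
  have "card (F \<union> Y) = N"
    using Y assms by (subst card_Un_disjoint) auto
  with Y assms show ?thesis
    by (intro that[of "F \<union> Y"]) auto
qed

lemma T_plus_system_nonvanishing:
  assumes "T_plus_system a b k g" "a < b" "t \<in> {a..b}"
  obtains i where "i \<le> k" "g i t \<noteq> 0"
proof -
  obtain X where X: "{t} \<subseteq> X" "X \<subseteq> {a..b}" "finite X" "card X = k + 1"
    using ex_superset_card_interval[of a b "{t}" "k + 1"] assms by auto
  then obtain x where x: "strict_mono_on {..k} x" "x ` {..k} = X"
    using ex_strict_mono_enumeration by blast
  then obtain j where j: "j \<le> k" "x j = t"
    using X by auto
  let ?A = "Matrix.mat (k + 1) (k + 1) (\<lambda>(i, j). g i (x j))"
  have "Determinant.det ?A = (\<Sum>i<k+1. ?A $$ (i, j) * cofactor ?A i j)"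
    using j by (intro laplace_expansion_column) auto
  also have "\<dots> = (\<Sum>i<k+1. g i t * cofactor ?A i j)"
    using j by (intro sum.cong) auto
  finally have "(\<Sum>i<k+1. g i t * cofactor ?A i j) \<noteq> 0"
    using T_plus_systemD(2)[OF assms(1) x(1)] x X by auto
  then obtain i where "i < k + 1" "g i t * cofactor ?A i j \<noteq> 0"
    by (meson lessThan_iff sum.neutral)
  then show ?thesis
    using that[of i] by auto
qed

text \<open>At every point some \<open>g\<^sub>i\<close> is nonzero, so by compactness \<open>\<Sum>\<bar>g\<^sub>i\<bar>\<close> is bounded below by a positive
constant. That constant is then integrable, which makes the measure finite.\<close>

lemma moment_measures_finite:
  assumes T: "T_plus_system a b n g" and "a < b" and \<mu>: "\<mu> \<in> moment_measures a b n g c"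
  shows "finite_measure \<mu>"
proof -
  define s where "s t = (\<Sum>i\<le>n. \<bar>g i t\<bar>)" for t
  have "continuous_on {a..b} s"
    unfolding s_def using T_plus_systemD(1)[OF T] by (intro continuous_intros) auto
  then obtain t0 where t0: "t0 \<in> {a..b}" "\<And>t. t \<in> {a..b} \<Longrightarrow> s t0 \<le> s t"
    using continuous_attains_inf[of "{a..b}" s] \<open>a < b\<close> by auto
  obtain i where i: "i \<le> n" "g i t0 \<noteq> 0"
    using T_plus_system_nonvanishing[OF T \<open>a < b\<close> t0(1)] .
  have "\<bar>g i t0\<bar> \<le> s t0"
    unfolding s_def using i by (intro member_le_sum) auto
  with i have pos: "s t0 > 0" by auto
  have sp: "space \<mu> = {a..b}"
    using borel_measures_onD(2)[OF moment_measuresD(1)[OF \<mu>]] .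
  have "integrable \<mu> s"
    unfolding s_def using moment_measuresD(2)[OF \<mu>] by (intro Bochner_Integration.integrable_sum integrable_abs) auto
  then have "(\<integral>\<^sup>+t. ennreal (norm (s t)) \<partial>\<mu>) < \<infinity>"
    by (simp add: integrable_iff_bounded)
  moreover have "ennreal (s t0) * emeasure \<mu> (space \<mu>) \<le> (\<integral>\<^sup>+t. ennreal (norm (s t)) \<partial>\<mu>)"
  proof -
    have "ennreal (s t0) * emeasure \<mu> (space \<mu>) = (\<integral>\<^sup>+t. ennreal (s t0) \<partial>\<mu>)"
      by simp
    also have "\<dots> \<le> (\<integral>\<^sup>+t. ennreal (norm (s t)) \<partial>\<mu>)"
      using t0(2) sp by (intro nn_integral_mono ennreal_leI) (auto intro: order_trans[OF _ abs_ge_self])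
    finally show ?thesis .
  qed
  ultimately have "emeasure \<mu> (space \<mu>) \<noteq> \<infinity>"
    using pos by (auto simp: ennreal_mult_top)
  then show ?thesis
    by (intro finite_measureI)
qed

lemma measure_support_subset:
  "\<mu> \<in> borel_measures_on a b \<Longrightarrow> measure_support \<mu> \<subseteq> {a..b}"
  using borel_measures_onD(2) by (auto simp: measure_support_def)

text \<open>Every point outside the support has a null neighbourhood from a countable basis, so countably many
null sets cover the complement.\<close>

lemma AE_in_measure_support:
  assumes \<mu>: "\<mu> \<in> borel_measures_on a b"
  shows "AE t in \<mu>. t \<in> measure_support \<mu>"
proof -
  note sp = borel_measures_onD(2)[OF \<mu>] and sets = borel_measures_on_sets[OF \<mu>]
  obtain B :: "real set set" where B: "countable B" "topological_basis B"
    using ex_countable_basis by blast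
  define F where "F = {V \<in> B. emeasure \<mu> (V \<inter> {a..b}) = 0}"
  have "(\<Union>V\<in>F. V \<inter> {a..b}) \<in> null_sets \<mu>"
  proof (rule null_sets_UN')
    show "countable F" using B(1) by (simp add: F_def)
    show "V \<inter> {a..b} \<in> null_sets \<mu>" if "V \<in> F" for V
      using that topological_basis_open[OF B(2)] by (auto simp: F_def sets null_sets_def)
  qed
  moreover have "{t \<in> space \<mu>. t \<notin> measure_support \<mu>} \<subseteq> (\<Union>V\<in>F. V \<inter> {a..b})"
  proof
    fix t assume t: "t \<in> {t \<in> space \<mu>. t \<notin> measure_support \<mu>}"
    then obtain U where U: "open U" "t \<in> U" "emeasure \<mu> (U \<inter> {a..b}) = 0"
      by (auto simp: measure_support_def sp not_gr_zero)
    obtain V where V: "V \<in> B" "t \<in> V" "V \<subseteq> U"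
      using topological_basisE[OF B(2) U(1,2)] by blast
    have "emeasure \<mu> (V \<inter> {a..b}) \<le> emeasure \<mu> (U \<inter> {a..b})"
      using V U by (intro emeasure_mono) (auto simp: sets)
    with U V t show "t \<in> (\<Union>V\<in>F. V \<inter> {a..b})"
      by (auto simp: F_def sp)
  qed
  ultimately show ?thesis by (rule AE_I')
qed

lemma integral_finite_support:
  fixes f :: "real \<Rightarrow> real"
  assumes \<mu>: "\<mu> \<in> borel_measures_on a b" "finite_measure \<mu>"
    and X: "finite X" "measure_support \<mu> \<subseteq> X" "X \<subseteq> {a..b}"
    and f: "continuous_on {a..b} f"
  shows "integral\<^sup>L \<mu> f = (\<Sum>x\<in>X. f x * Sigma_Algebra.measure \<mu> {x})"
proof -
  interpret finite_measure \<mu> by fact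
  have sing: "{x} \<in> sets \<mu>" if "x \<in> X" for x
    using that X by (auto simp: borel_measures_on_sets[OF \<mu>(1)])
  have int: "integrable \<mu> (\<lambda>t. f x * indicator {x} t)" if "x \<in> X" for x
    using sing[OF that] by (intro integrable_mult_right integrable_real_indicator) (auto simp: emeasure_eq_measure)
  have "AE t in \<mu>. f t = (\<Sum>x\<in>X. f x * indicator {x} t)"
    using AE_in_measure_support[OF \<mu>(1)]
  proof eventually_elim
    case (elim t)
    then have "(\<Sum>x\<in>X. f x * indicator {x} t) = (\<Sum>x\<in>{t}. f x * indicator {x} t)"
      using X by (intro sum.mono_neutral_right) (auto simp: indicator_def)
    then show ?case by simp
  qed
  then have "integral\<^sup>L \<mu> f = (\<integral>t. (\<Sum>x\<in>X. f x * indicator {x} t) \<partial>\<mu>)"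
    using borel_measures_on_integrable[OF \<mu> f] int
    by (intro integral_cong_AE borel_measurable_sum borel_measurable_integrable)
  also have "\<dots> = (\<Sum>x\<in>X. f x * Sigma_Algebra.measure \<mu> {x})"
    using int sing by (subst Bochner_Integration.integral_sum) (auto intro!: sum.cong)
  finally show ?thesis .
qed

lemma measure_eqI_finite_support:
  assumes \<mu>: "\<mu> \<in> borel_measures_on a b" "finite_measure \<mu>"
    and \<nu>: "\<nu> \<in> borel_measures_on a b" "finite_measure \<nu>"
    and X: "finite X" "measure_support \<mu> \<subseteq> X" "measure_support \<nu> \<subseteq> X" "X \<subseteq> {a..b}"
    and eq: "\<And>x. x \<in> X \<Longrightarrow> Sigma_Algebra.measure \<mu> {x} = Sigma_Algebra.measure \<nu> {x}"
  shows "\<mu> = \<nu>"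
proof (rule measure_eqI)
  show "sets \<mu> = sets \<nu>"
    using borel_measures_onD[OF \<mu>(1)] borel_measures_onD[OF \<nu>(1)] by simp
  fix A assume A: "A \<in> sets \<mu>"
  have *: "emeasure \<rho> A = (\<Sum>x\<in>A \<inter> X. emeasure \<rho> {x})"
    if \<rho>: "\<rho> \<in> borel_measures_on a b" "measure_support \<rho> \<subseteq> X" for \<rho>
  proof -
    have AX: "A \<in> sets \<rho>" "A \<inter> X \<in> sets \<rho>" "\<And>x. x \<in> X \<Longrightarrow> {x} \<in> sets \<rho>"
      using A X finite_imp_closed[OF finite_Int[of A X]]
      by (auto simp: borel_measures_on_sets[OF \<mu>(1)] borel_measures_on_sets[OF \<rho>(1)])
    have "emeasure \<rho> A = emeasure \<rho> (A \<inter> X)"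
      using AE_in_measure_support[OF \<rho>(1)] \<rho>(2) AX
      by (intro emeasure_eq_AE) (auto elim!: eventually_mono)
    also have "\<dots> = (\<Sum>x\<in>A \<inter> X. emeasure \<rho> {x})"
      using X AX by (intro emeasure_eq_sum_singleton) auto
    finally show ?thesis .
  qed
  have "emeasure \<mu> {x} = emeasure \<nu> {x}" if "x \<in> X" for x
    using eq[OF that] \<mu>(2) \<nu>(2) by (simp add: finite_measure.emeasure_eq_measure)
  then show "emeasure \<mu> A = emeasure \<nu> A"
    using *[OF \<mu>(1) X(2)] *[OF \<nu>(1) X(3)] by simp
qed

lemma T_plus_system_independent:
  assumes T: "T_plus_system a b k g" and x: "strict_mono_on {..k} x" "x ` {..k} \<subseteq> {a..b}"
    and zero: "\<And>i. i \<le> k \<Longrightarrow> (\<Sum>j\<le>k. g i (x j) * w j) = 0" and "j \<le> k"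
  shows "w j = 0"
proof -
  let ?A = "Matrix.mat (k + 1) (k + 1) (\<lambda>(i, j). g i (x j))"
  let ?w = "Matrix.vec (k + 1) w"
  have A: "?A \<in> carrier_mat (k + 1) (k + 1)" by simp
  have "?A *\<^sub>v ?w = 0\<^sub>v (k + 1)"
    using zero by (auto simp: scalar_prod_def atLeast0LessThan lessThan_Suc_atMost intro!: eq_vecI)
  moreover have "Determinant.det ?A \<noteq> 0"
    using T_plus_systemD(2)[OF T x] by simp
  ultimately have "?w = 0\<^sub>v (k + 1)"
    using det_0_iff_vec_prod_zero_field[OF A] by (metis vec_carrier)
  then show ?thesis
    using \<open>j \<le> k\<close> by (metis index_vec index_zero_vec(1) less_Suc_eq_le Suc_eq_plus1)
qed

text \<open>The differences of the point masses at \<open>n + 1\<close> points solve a homogeneous linear system whose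
determinant is positive.\<close>

lemma moments_determine_finite_support:
  assumes T: "T_plus_system a b n g" and "a < b"
    and \<mu>: "\<mu> \<in> borel_measures_on a b" "finite_measure \<mu>"
    and \<nu>: "\<nu> \<in> borel_measures_on a b" "finite_measure \<nu>"
    and F: "finite F" "card F \<le> n + 1" "measure_support \<mu> \<subseteq> F" "measure_support \<nu> \<subseteq> F" "F \<subseteq> {a..b}"
    and eq: "\<And>i. i \<le> n \<Longrightarrow> integral\<^sup>L \<mu> (g i) = integral\<^sup>L \<nu> (g i)"
  shows "\<mu> = \<nu>"
proof -
  obtain X where X: "F \<subseteq> X" "X \<subseteq> {a..b}" "finite X" "card X = n + 1"
    using ex_superset_card_interval[OF \<open>a < b\<close> F(1,5,2)] .
  then obtain x where x: "strict_mono_on {..n} x" "x ` {..n} = X"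
    using ex_strict_mono_enumeration by blast
  then have inj: "inj_on x {..n}"
    using strict_mono_on_imp_inj_on by blast
  have expand: "integral\<^sup>L \<rho> (g i) = (\<Sum>j\<le>n. g i (x j) * Sigma_Algebra.measure \<rho> {x j})"
    if "\<rho> \<in> borel_measures_on a b" "finite_measure \<rho>" "measure_support \<rho> \<subseteq> F" "i \<le> n" for \<rho> i
    using integral_finite_support[OF that(1,2) X(3) _ X(2) T_plus_systemD(1)[OF T \<open>i \<le> n\<close>]] that(3) X(1)
    by (simp add: x(2)[symmetric] sum.reindex[OF inj] subset_trans)
  define w where "w j = Sigma_Algebra.measure \<mu> {x j} - Sigma_Algebra.measure \<nu> {x j}" for j
  have "(\<Sum>j\<le>n. g i (x j) * w j) = 0" if "i \<le> n" for i
    using eq[OF that] expand[OF \<mu> F(3) that] expand[OF \<nu> F(4) that]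
    by (simp add: w_def right_diff_distrib sum_subtractf)
  then have w: "w j = 0" if "j \<le> n" for j
    using T_plus_system_independent[OF T x(1)] x(2) X(2) that by blast
  show ?thesis
  proof (rule measure_eqI_finite_support[OF \<mu> \<nu> X(3) _ _ X(2)])
    show "Sigma_Algebra.measure \<mu> {y} = Sigma_Algebra.measure \<nu> {y}" if "y \<in> X" for y
      using that w x(2) by (auto simp: w_def)
  qed (use F X in auto)
qed

text \<open>The restriction of \<open>\<mu>\<close> to \<open>J\<close> is kept as a measure on all of \<open>[a, b]\<close>, so that it can be
compared and combined with other measures there.\<close>

lemma density_indicator:
  assumes \<mu>: "\<mu> \<in> borel_measures_on a b" "finite_measure \<mu>" and J: "J \<in> sets \<mu>"
  defines "\<kappa> \<equiv> density \<mu> (indicator J)"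
  shows "\<kappa> \<in> borel_measures_on a b" "finite_measure \<kappa>" "AE t in \<kappa>. t \<in> J"
    and "emeasure \<kappa> {a..b} = emeasure \<mu> J"
    and "\<And>f :: real \<Rightarrow> real. continuous_on {a..b} f \<Longrightarrow> integral\<^sup>L \<kappa> f = (\<integral>t. indicator J t * f t \<partial>\<mu>)"
proof -
  interpret finite_measure \<mu> by fact
  show "\<kappa> \<in> borel_measures_on a b"
    using \<mu>(1) by (simp add: \<kappa>_def borel_measures_on_def)
  show em: "emeasure \<kappa> {a..b} = emeasure \<mu> J"
  proof -
    have "{a..b} \<in> sets \<mu>" "J \<inter> {a..b} = J"
      using J by (auto simp: borel_measures_on_sets[OF \<mu>(1)])
    then show ?thesis
      unfolding \<kappa>_def using emeasure_restricted[OF J] by metis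
  qed
  show "finite_measure \<kappa>"
    using em borel_measures_onD(2)[OF \<mu>(1)] by (intro finite_measureI) (simp add: \<kappa>_def)
  show "AE t in \<kappa>. t \<in> J"
    unfolding \<kappa>_def using J by (subst AE_density) (auto simp: indicator_def)
  show "integral\<^sup>L \<kappa> f = (\<integral>t. indicator J t * f t \<partial>\<mu>)" if "continuous_on {a..b} f" for f :: "real \<Rightarrow> real"
    unfolding \<kappa>_def ennreal_indicator[symmetric]
    using J borel_measures_on_measurable[OF \<mu>(1) that]
    by (subst integral_density) auto
qed

lemma emeasure_support_pos:
  assumes \<mu>: "\<mu> \<in> borel_measures_on a b" and "t \<in> measure_support \<mu>" "open U" "t \<in> U"
    and "U \<inter> {a..b} \<subseteq> J" "J \<in> sets \<mu>"
  shows "emeasure \<mu> J > 0"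
proof -
  have "0 < emeasure \<mu> (U \<inter> {a..b})"
    using assms(2,3,4) by (auto simp: measure_support_def borel_measures_onD(2)[OF \<mu>])
  also have "\<dots> \<le> emeasure \<mu> J"
    using assms by (intro emeasure_mono) auto
  finally show ?thesis .
qed

text \<open>If the support has at most \<open>n\<close> points, the moments determine the point masses. Otherwise, cut
\<open>[a, b]\<close> between \<open>n + 1\<close> support points into consecutive pieces of positive measure. The moment
matrix of the pieces has positive determinant, yet its columns add up to the moments of \<open>\<mu>\<close>, which
are zero.\<close>

lemma zero_moments_imp_zero:
  assumes T: "T_plus_system a b n g" and "a < b"
    and \<mu>: "\<mu> \<in> borel_measures_on a b" "finite_measure \<mu>"
    and zero: "\<And>i. i \<le> n \<Longrightarrow> integral\<^sup>L \<mu> (g i) = 0"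
  shows "emeasure \<mu> {a..b} = 0"
proof (cases "finite (measure_support \<mu>) \<and> card (measure_support \<mu>) \<le> n")
  case True
  let ?Z = "null_measure \<mu>"
  have Z: "?Z \<in> borel_measures_on a b" "finite_measure ?Z" "measure_support ?Z \<subseteq> measure_support \<mu>"
    using \<mu>(1) by (auto simp: borel_measures_on_def measure_support_def intro!: finite_measureI)
  have "\<mu> = ?Z"
    using True zero
    by (intro moments_determine_finite_support[OF T \<open>a < b\<close> \<mu> Z(1,2), of "measure_support \<mu>"])
       (auto simp: Z(3) measure_support_subset[OF \<mu>(1), THEN subsetD] measure_support_subset[OF \<mu>(1)] integral_null_measure)
  then show ?thesis
    by (metis emeasure_null_measure)
next
  case False
  have "\<exists>Y. Y \<subseteq> measure_support \<mu> \<and> finite Y \<and> card Y = n + 1"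
  proof (cases "finite (measure_support \<mu>)")
    case True
    with False have "n + 1 \<le> card (measure_support \<mu>)" by simp
    from obtain_subset_with_card_n[OF this] show ?thesis by metis
  qed (use infinite_arbitrarily_large in blast)
  then obtain Y x where Y: "Y \<subseteq> measure_support \<mu>" and x: "strict_mono_on {..n} x" "x ` {..n} = Y"
    using ex_strict_mono_enumeration by metis
  \<comment> \<open>The cut points; piece \<open>J j\<close> lies between the cuts \<open>d (j - 1)\<close> and \<open>d j\<close>, and \<open>U j\<close> is its interior.\<close>
  define d where "d j = (x j + x (Suc j)) / 2" for j
  define J where "J j = {t \<in> {a..b}. (\<forall>i<j. d i < t) \<and> (j < n \<longrightarrow> t \<le> d j)}" for j
  define U where "U j = (\<Inter>i\<in>{..<j}. {d i<..}) \<inter> (if j < n then {..<d j} else UNIV)" for j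
  have sep: "s < t" if "i < j" "j \<le> n" "s \<in> J i" "t \<in> J j" for i j s t
    using that by (auto simp: J_def intro: le_less_trans)
  have J_sets: "J j \<in> sets \<mu>" for j
  proof -
    have "J j = {a..b} \<inter> (\<Inter>i\<in>{..<j}. {d i<..}) \<inter> (if j < n then {..d j} else UNIV)"
      by (auto simp: J_def)
    also have "\<dots> \<in> sets borel"
      by (cases "j = 0") auto
    finally show ?thesis
      by (auto simp: borel_measures_on_sets[OF \<mu>(1)] J_def)
  qed
  have x_mono: "x i \<le> x j" if "i \<le> j" "j \<le> n" for i j
    using x(1) that by (cases "i = j") (auto simp: strict_mono_on_def less_imp_le)
  have x_less: "x j < x (Suc j)" if "j < n" for j
    using x(1) that by (auto simp: strict_mono_on_def)
  have J_pos: "emeasure \<mu> (J j) > 0" if "j \<le> n" for j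
  proof (rule emeasure_support_pos[OF \<mu>(1) _ _ _ _ J_sets])
    show "x j \<in> measure_support \<mu>"
      using Y x(2) that by auto
    show "open (U j)" unfolding U_def by (intro open_Int open_INT) auto
    have "d i < x j" if "i < j" for i
      using x_less[of i] x_mono[of "Suc i" j] that \<open>j \<le> n\<close> by (simp add: d_def)
    moreover have "x j < d j" if "j < n"
      using x_less[OF that] by (simp add: d_def)
    ultimately show "x j \<in> U j" by (auto simp: U_def)
    show "U j \<inter> {a..b} \<subseteq> J j" by (auto simp: U_def J_def split: if_splits)
  qed
  have cover: "(\<Sum>j\<le>n. indicator (J j) t) = (1::real)" if "t \<in> {a..b}" for t
  proof -
    define k where "k = (LEAST k. k < n \<longrightarrow> t \<le> d k)"
    have k1: "k < n \<longrightarrow> t \<le> d k" and k2: "k \<le> n"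
      unfolding k_def by (rule LeastI[of _ n], simp, rule Least_le, simp)
    have "d i < t" if "i < k" for i
      using not_less_Least[of i "\<lambda>k. k < n \<longrightarrow> t \<le> d k"] that by (auto simp: k_def)
    then have tk: "t \<in> J k"
      using k1 that by (auto simp: J_def)
    have "j = k" if "t \<in> J j" "j \<le> n" for j
      using sep[OF _ _ tk that(1)] sep[OF _ _ that(1) tk] that(2) k2
      by (metis less_irrefl linorder_neqE_nat)
    then have "(\<Sum>j\<le>n. indicator (J j) t) = (\<Sum>j\<in>{k}. indicator (J j) t :: real)"
      using k2 by (intro sum.mono_neutral_right) (auto simp: indicator_def)
    then show ?thesis using tk by simp
  qed
  define \<nu> where "\<nu> j = density \<mu> (indicator (J j))" for j
  note D = density_indicator[OF \<mu> J_sets, folded \<nu>_def]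
  let ?A = "Matrix.mat (n + 1) (n + 1) (\<lambda>(i, j). integral\<^sup>L (\<nu> j) (g i))"
  have "Determinant.det ?A > 0"
  proof (rule det_moments_pos[OF T, where J=J])
    show "emeasure (\<nu> j) {a..b} \<noteq> 0" if "j \<le> n" for j
      using J_pos[OF that] by (simp add: D(4))
    show "s < t" if "i < j" "j \<le> n" "s \<in> J i" "t \<in> J j" for i j s t
      using sep[OF that] .
    show "J j \<subseteq> {a..b}" for j by (auto simp: J_def)
  qed (rule D)+
  moreover have "Determinant.det ?A = 0"
  proof -
    have A: "?A \<in> carrier_mat (n + 1) (n + 1)" by simp
    \<comment> \<open>The all-ones vector is in the kernel, since the pieces partition \<open>[a, b]\<close>.\<close>
    let ?w = "Matrix.vec (n + 1) (\<lambda>_. 1 :: real)"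
    have "(\<Sum>j\<le>n. integral\<^sup>L (\<nu> j) (g i)) = 0" if "i \<le> n" for i
    proof -
      have c: "continuous_on {a..b} (g i)" using T_plus_systemD(1)[OF T that] .
      have "(\<Sum>j\<le>n. integral\<^sup>L (\<nu> j) (g i)) = (\<Sum>j\<le>n. \<integral>t. indicator (J j) t * g i t \<partial>\<mu>)"
        using D(5)[OF c] by simp
      also have "\<dots> = (\<integral>t. (\<Sum>j\<le>n. indicator (J j) t * g i t) \<partial>\<mu>)"
        using integrable_real_mult_indicator[OF J_sets borel_measures_on_integrable[OF \<mu> c]]
        by (subst Bochner_Integration.integral_sum) (simp_all add: mult.commute)
      also have "\<dots> = integral\<^sup>L \<mu> (g i)"
        using cover borel_measures_onD(2)[OF \<mu>(1)]
        by (intro Bochner_Integration.integral_cong refl) (simp add: sum_distrib_right[symmetric])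
      finally show ?thesis using zero[OF that] by simp
    qed
    then have "?A *\<^sub>v ?w = 0\<^sub>v (n + 1)"
      by (auto simp: scalar_prod_def atLeast0LessThan lessThan_Suc_atMost intro!: eq_vecI)
    moreover have "?w \<noteq> 0\<^sub>v (n + 1)"
      by (metis index_vec index_zero_vec(1) zero_less_Suc Suc_eq_plus1 zero_neq_one)
    ultimately show ?thesis
      using det_0_iff_vec_prod_zero_field[OF A] by (metis vec_carrier)
  qed
  ultimately show ?thesis by simp
qed

section \<open>Weak compactness of the moment class\<close>

text \<open>Probability measures on \<open>[a, b]\<close>, seen as distributions on the line, form a tight family, so
Helly's theorem gives a weak limit on the line. Pushing the limit forward along the retraction of the
line onto \<open>[a, b]\<close> returns it to \<open>[a, b]\<close>, and composing a test function with the same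
retraction extends it to a bounded continuous function on the line.\<close>

lemma weak_compactness_prob:
  fixes \<rho> :: "nat \<Rightarrow> real measure"
  assumes "a < b" and \<rho>: "\<And>k. \<rho> k \<in> borel_measures_on a b" "\<And>k. prob_space (\<rho> k)"
  obtains r \<rho>' where "strict_mono (r :: nat \<Rightarrow> nat)" "\<rho>' \<in> borel_measures_on a b" "prob_space \<rho>'"
    "\<And>f :: real \<Rightarrow> real. continuous_on {a..b} f \<Longrightarrow> (\<lambda>k. integral\<^sup>L (\<rho> (r k)) f) \<longlonglongrightarrow> integral\<^sup>L \<rho>' f"
proof -
  define P where "P k = distr (\<rho> k) borel (\<lambda>x. x)" for k
  have id_meas: "(\<lambda>x. x) \<in> borel_measurable (\<rho> k)" for k
    by (intro borel_measures_on_measurable[OF \<rho>(1)] continuous_intros)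
  have P: "real_distribution (P k)" for k
    unfolding P_def using id_meas by (intro prob_space.real_distribution_distr \<rho>(2))
  have "tight P"
    unfolding tight_def
  proof (intro conjI allI impI P)
    fix e :: real assume "e > 0"
    have "Sigma_Algebra.measure (P k) {a - 1<..b} = 1" for k
    proof -
      have "Sigma_Algebra.measure (P k) {a - 1<..b} = Sigma_Algebra.measure (\<rho> k) ((\<lambda>x. x) -` {a - 1<..b} \<inter> space (\<rho> k))"
        unfolding P_def using id_meas by (intro measure_distr) auto
      also have "(\<lambda>x. x) -` {a - 1<..b} \<inter> space (\<rho> k) = space (\<rho> k)"
        using borel_measures_onD(2)[OF \<rho>(1)] by auto
      finally show ?thesis
        using prob_space.prob_space[OF \<rho>(2)] by simp
    qed
    with \<open>a < b\<close> \<open>e > 0\<close> show "\<exists>u v. u < v \<and> (\<forall>k. 1 - e < Sigma_Algebra.measure (P k) {u<..v})"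
      by (intro exI[of _ "a - 1"] exI[of _ b]) auto
  qed
  then obtain r M where r: "strict_mono r" and M: "real_distribution M" "weak_conv_m (P \<circ> r) M"
    using tight_imp_convergent_subsubsequence[of P id] by (auto simp: strict_mono_id)
  define clamp :: "real \<Rightarrow> real" where "clamp t = max a (min b t)" for t
  have clamp: "clamp t \<in> {a..b}" "t \<in> {a..b} \<Longrightarrow> clamp t = t" for t
    using \<open>a < b\<close> by (auto simp: clamp_def)
  have clamp_cont: "continuous_on S clamp" for S
    unfolding clamp_def by (intro continuous_intros)
  interpret M: real_distribution M by fact
  have clamp_meas: "clamp \<in> measurable M (restrict_space borel {a..b})"
    using clamp borel_measurable_continuous_onI[OF clamp_cont]
    by (intro measurable_restrict_space2)
       (auto simp: measurable_cong_sets[OF M.events_eq_borel refl])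
  define \<rho>' where "\<rho>' = distr M (restrict_space borel {a..b}) clamp"
  show ?thesis
  proof (rule that[OF r])
    show "\<rho>' \<in> borel_measures_on a b"
      by (simp add: \<rho>'_def borel_measures_on_def)
    show "prob_space \<rho>'"
      unfolding \<rho>'_def using clamp_meas by (rule M.prob_space_distr)
    fix f :: "real \<Rightarrow> real" assume f: "continuous_on {a..b} f"
    define F where "F t = f (clamp t)" for t
    have F: "continuous_on UNIV F"
      unfolding F_def using clamp by (intro continuous_on_compose2[OF f clamp_cont]) auto
    have "bounded (f ` {a..b})"
      using compact_continuous_image[OF f] compact_imp_bounded by blast
    then obtain B where "\<forall>x\<in>{a..b}. norm (f x) \<le> B"
      by (auto simp: bounded_iff)
    then have bound: "norm (F t) \<le> B" for t
      using clamp by (simp add: F_def)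
    have "(\<lambda>k. integral\<^sup>L ((P \<circ> r) k) F) \<longlonglongrightarrow> integral\<^sup>L M F"
      using P F bound
      by (intro weak_conv_imp_integral_bdd_continuous_conv[OF _ M, of F B])
         (auto simp: continuous_on_eq_continuous_at)
    moreover have "integral\<^sup>L ((P \<circ> r) k) F = integral\<^sup>L (\<rho> (r k)) f" for k
    proof -
      have "integral\<^sup>L ((P \<circ> r) k) F = integral\<^sup>L (\<rho> (r k)) F"
        unfolding P_def comp_def using id_meas borel_measurable_continuous_onI[OF F]
        by (intro integral_distr) auto
      also have "\<dots> = integral\<^sup>L (\<rho> (r k)) f"
        using clamp borel_measures_onD(2)[OF \<rho>(1)]
        by (intro Bochner_Integration.integral_cong) (auto simp: F_def)
      finally show ?thesis .
    qed
    moreover have "integral\<^sup>L \<rho>' f = integral\<^sup>L M F"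
      unfolding \<rho>'_def F_def
      using clamp_meas borel_measurable_continuous_on_restrict[OF f] by (intro integral_distr)
    ultimately show "(\<lambda>k. integral\<^sup>L (\<rho> (r k)) f) \<longlonglongrightarrow> integral\<^sup>L \<rho>' f"
      by simp
  qed
qed

lemma borel_measures_on_scale:
  assumes \<mu>: "\<mu> \<in> borel_measures_on a b" "finite_measure \<mu>" and "c \<ge> 0"
  obtains \<nu> where "\<nu> \<in> borel_measures_on a b" "finite_measure \<nu>"
    "emeasure \<nu> {a..b} = ennreal c * emeasure \<mu> {a..b}"
    "\<And>f :: real \<Rightarrow> real. continuous_on {a..b} f \<Longrightarrow> integral\<^sup>L \<nu> f = c * integral\<^sup>L \<mu> f"
proof -
  define \<nu> where "\<nu> = density \<mu> (\<lambda>_. ennreal c)"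
  interpret finite_measure \<mu> by fact
  note sp = borel_measures_onD(2)[OF \<mu>(1)]
  have em: "emeasure \<nu> {a..b} = ennreal c * emeasure \<mu> {a..b}"
    unfolding \<nu>_def sp[symmetric] by (subst emeasure_density_const) auto
  show ?thesis
  proof (rule that[of \<nu>])
    show "\<nu> \<in> borel_measures_on a b"
      using \<mu>(1) by (simp add: \<nu>_def borel_measures_on_def)
    show "finite_measure \<nu>"
    proof (rule finite_measureI)
      have "space \<nu> = {a..b}" by (simp add: \<nu>_def sp)
      then show "emeasure \<nu> (space \<nu>) \<noteq> \<infinity>"
        using em emeasure_finite[of "{a..b}"] by (simp add: ennreal_mult_eq_top_iff)
    qed
    show "integral\<^sup>L \<nu> f = c * integral\<^sup>L \<mu> f" if "continuous_on {a..b} f" for f :: "real \<Rightarrow> real"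
      unfolding \<nu>_def using \<open>c \<ge> 0\<close> borel_measures_on_measurable[OF \<mu>(1) that]
      by (subst integral_density) auto
  qed (rule em)
qed

lemma dirac_borel_measures_on:
  fixes a b t :: real
  assumes "t \<in> {a..b}"
  defines "\<delta> \<equiv> return (restrict_space borel {a..b}) t"
  shows "\<delta> \<in> borel_measures_on a b" "prob_space \<delta>"
    and "\<And>f :: real \<Rightarrow> real. continuous_on {a..b} f \<Longrightarrow> integral\<^sup>L \<delta> f = f t"
    and "\<And>J. J \<in> sets borel \<Longrightarrow> t \<in> J \<Longrightarrow> AE s in \<delta>. s \<in> J"
proof -
  have t: "t \<in> space (restrict_space borel {a..b})"
    using assms(1) by (simp add: space_restrict_space)
  show "\<delta> \<in> borel_measures_on a b"
    by (simp add: \<delta>_def borel_measures_on_def)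
  show "prob_space \<delta>"
    unfolding \<delta>_def by (rule prob_space_return[OF t])
  show "integral\<^sup>L \<delta> f = f t" if "continuous_on {a..b} f" for f :: "real \<Rightarrow> real"
    unfolding \<delta>_def by (rule integral_return[OF t borel_measurable_continuous_on_restrict[OF that]])
  show "AE s in \<delta>. s \<in> J" if "J \<in> sets borel" "t \<in> J" for J
  proof -
    have "J \<inter> {a..b} \<in> sets (restrict_space borel {a..b})"
      using that by (simp add: sets_restrict_space_iff)
    then have "Measurable.pred (restrict_space borel {a..b}) (\<lambda>s. s \<in> J)"
      unfolding pred_def by (simp add: space_restrict_space Int_def conj_commute)
    with t that(2) show ?thesis
      unfolding \<delta>_def by (subst AE_return)
  qed
qed

text \<open>The zero measure is included, with an arbitrary \<open>\<rho>\<close>, so that a sequence of measures can be normalized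
term by term without a case distinction.\<close>

lemma borel_measures_on_normalize:
  assumes "a < b" and \<mu>: "\<mu> \<in> borel_measures_on a b" "finite_measure \<mu>"
  obtains \<rho> where "\<rho> \<in> borel_measures_on a b" "prob_space \<rho>"
    "\<And>f :: real \<Rightarrow> real. continuous_on {a..b} f \<Longrightarrow> integral\<^sup>L \<mu> f = Sigma_Algebra.measure \<mu> {a..b} * integral\<^sup>L \<rho> f"
proof (cases "Sigma_Algebra.measure \<mu> {a..b} = 0")
  case True
  interpret finite_measure \<mu> by fact
  have "emeasure \<mu> (space \<mu>) = 0"
    using True borel_measures_onD(2)[OF \<mu>(1)] by (simp add: emeasure_eq_measure)
  then have "AE t in \<mu>. f t = 0" for f :: "real \<Rightarrow> real"
    by (intro AE_I'[of "space \<mu>"]) (auto simp: null_sets_def)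
  then have "integral\<^sup>L \<mu> f = 0" for f :: "real \<Rightarrow> real"
    by (rule integral_eq_zero_AE)
  with True dirac_borel_measures_on(1,2)[of a a b] \<open>a < b\<close> show ?thesis
    by (intro that[of "return (restrict_space borel {a..b}) a"]) auto
next
  case False
  let ?m = "Sigma_Algebra.measure \<mu> {a..b}"
  have pos: "?m > 0" using False by (simp add: zero_less_measure_iff)
  interpret finite_measure \<mu> by fact
  obtain \<nu> where \<nu>: "\<nu> \<in> borel_measures_on a b" "emeasure \<nu> {a..b} = ennreal (1 / ?m) * emeasure \<mu> {a..b}"
    "\<And>f :: real \<Rightarrow> real. continuous_on {a..b} f \<Longrightarrow> integral\<^sup>L \<nu> f = (1 / ?m) * integral\<^sup>L \<mu> f"
    using borel_measures_on_scale[OF \<mu>, of "1 / ?m"] pos by auto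
  have "emeasure \<nu> {a..b} = 1"
    using pos by (simp add: \<nu>(2) emeasure_eq_measure ennreal_mult[symmetric])
  then have "prob_space \<nu>"
    by (intro prob_spaceI) (simp add: borel_measures_onD(2)[OF \<nu>(1)])
  with \<nu> pos show ?thesis
    by (intro that[of \<nu>]) auto
qed

text \<open>If the masses were unbounded, the normalized measures would have moments tending to zero, and a weak
limit would be a probability measure whose moments all vanish.\<close>

lemma moment_measures_bounded_mass:
  assumes T: "T_plus_system a b n g" and "a < b"
  obtains B where "\<And>\<mu>. \<mu> \<in> moment_measures a b n g c \<Longrightarrow> Sigma_Algebra.measure \<mu> {a..b} \<le> B"
proof (rule ccontr)
  assume neg: "\<not> thesis"
  have "\<exists>\<mu> \<in> moment_measures a b n g c. Sigma_Algebra.measure \<mu> {a..b} > real k" for k :: nat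
    using neg that[of "real k"] by (meson not_le)
  then obtain \<mu> where \<mu>: "\<And>k. \<mu> k \<in> moment_measures a b n g c"
      "\<And>k. Sigma_Algebra.measure (\<mu> k) {a..b} > real k"
    by metis
  have "\<exists>\<rho>. \<rho> \<in> borel_measures_on a b \<and> prob_space \<rho> \<and> (\<forall>f :: real \<Rightarrow> real. continuous_on {a..b} f \<longrightarrow>
      integral\<^sup>L (\<mu> k) f = Sigma_Algebra.measure (\<mu> k) {a..b} * integral\<^sup>L \<rho> f)" for k
    using borel_measures_on_normalize[OF \<open>a < b\<close> moment_measuresD(1)[OF \<mu>(1)]
        moment_measures_finite[OF T \<open>a < b\<close> \<mu>(1)]] by metis
  then obtain \<rho> where \<rho>: "\<And>k. \<rho> k \<in> borel_measures_on a b" "\<And>k. prob_space (\<rho> k)"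
    "\<And>k f. continuous_on {a..b} f \<Longrightarrow>
      integral\<^sup>L (\<mu> k) f = Sigma_Algebra.measure (\<mu> k) {a..b} * (integral\<^sup>L (\<rho> k) f :: real)"
    by metis
  obtain r \<rho>' where r: "strict_mono r" and \<rho>': "\<rho>' \<in> borel_measures_on a b" "prob_space \<rho>'"
    and lim: "\<And>f :: real \<Rightarrow> real. continuous_on {a..b} f \<Longrightarrow> (\<lambda>k. integral\<^sup>L (\<rho> (r k)) f) \<longlonglongrightarrow> integral\<^sup>L \<rho>' f"
    by (rule weak_compactness_prob[OF \<open>a < b\<close>, where \<rho>=\<rho>]) (use \<rho> in auto)
  let ?m = "\<lambda>k. Sigma_Algebra.measure (\<mu> (r k)) {a..b}"
  have m: "?m k > real k" for k
    using \<mu>(2)[of "r k"] seq_suble[OF r, of k] by linarith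
  then have "filterlim ?m at_top sequentially"
    by (intro filterlim_at_top_mono[OF filterlim_real_sequentially] always_eventually) (simp add: less_imp_le)
  then have inv: "(\<lambda>k. inverse (?m k)) \<longlonglongrightarrow> 0"
    by (rule tendsto_inverse_0_at_top)
  have "integral\<^sup>L \<rho>' (g i) = 0" if "i \<le> n" for i
  proof -
    note cont = T_plus_systemD(1)[OF T that]
    have "integral\<^sup>L (\<rho> (r k)) (g i) = inverse (?m k) * c i" for k
    proof -
      have "?m k * integral\<^sup>L (\<rho> (r k)) (g i) = c i"
        using \<rho>(3)[OF cont] moment_measuresD(3)[OF \<mu>(1) that] by metis
      moreover have "?m k \<noteq> 0" using m[of k] by linarith
      ultimately show ?thesis by (simp add: field_simps)
    qed
    then have "(\<lambda>k. integral\<^sup>L (\<rho> (r k)) (g i)) \<longlonglongrightarrow> 0 * c i"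
      using tendsto_mult_right[OF inv, of "c i"] by simp
    then show ?thesis
      using lim[OF cont] LIMSEQ_unique by fastforce
  qed
  then have "emeasure \<rho>' {a..b} = 0"
    by (intro zero_moments_imp_zero[OF T \<open>a < b\<close> \<rho>'(1)] prob_space.finite_measure \<rho>'(2))
  then show False
    using prob_space.emeasure_space_1[OF \<rho>'(2)] borel_measures_onD(2)[OF \<rho>'(1)] by simp
qed

lemma moment_measures_seq_compact:
  assumes T: "T_plus_system a b n g" and "a < b"
    and \<mu>: "\<And>k :: nat. \<mu> k \<in> moment_measures a b n g c"
  obtains r \<mu>' where "strict_mono (r :: nat \<Rightarrow> nat)" "\<mu>' \<in> moment_measures a b n g c"
    "\<And>f :: real \<Rightarrow> real. continuous_on {a..b} f \<Longrightarrow> (\<lambda>k. integral\<^sup>L (\<mu> (r k)) f) \<longlonglongrightarrow> integral\<^sup>L \<mu>' f"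
proof -
  let ?m = "\<lambda>k. Sigma_Algebra.measure (\<mu> k) {a..b}"
  obtain B where B: "\<And>k. ?m k \<le> B"
    using moment_measures_bounded_mass[OF T \<open>a < b\<close>] \<mu> by metis
  have "\<forall>k. ?m k \<in> {0..B}"
    using B by (auto simp: measure_nonneg)
  then obtain m r1 where m: "m \<in> {0..B}" "strict_mono r1" "(?m \<circ> r1) \<longlonglongrightarrow> m"
    using compact_imp_seq_compact[OF compact_Icc] unfolding seq_compact_def by metis
  have "\<exists>\<rho>. \<rho> \<in> borel_measures_on a b \<and> prob_space \<rho> \<and> (\<forall>f :: real \<Rightarrow> real. continuous_on {a..b} f \<longrightarrow>
      integral\<^sup>L (\<mu> k) f = ?m k * integral\<^sup>L \<rho> f)" for k
    using borel_measures_on_normalize[OF \<open>a < b\<close> moment_measuresD(1)[OF \<mu>]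
        moment_measures_finite[OF T \<open>a < b\<close> \<mu>]] by metis
  then obtain \<rho> where \<rho>: "\<And>k. \<rho> k \<in> borel_measures_on a b" "\<And>k. prob_space (\<rho> k)"
    "\<And>k f. continuous_on {a..b} f \<Longrightarrow> integral\<^sup>L (\<mu> k) f = ?m k * (integral\<^sup>L (\<rho> k) f :: real)"
    by metis
  obtain r2 \<rho>' where r2: "strict_mono r2" and \<rho>': "\<rho>' \<in> borel_measures_on a b" "prob_space \<rho>'"
    and lim: "\<And>f :: real \<Rightarrow> real. continuous_on {a..b} f \<Longrightarrow>
      (\<lambda>k. integral\<^sup>L (\<rho> (r1 (r2 k))) f) \<longlonglongrightarrow> integral\<^sup>L \<rho>' f"
    by (rule weak_compactness_prob[OF \<open>a < b\<close>, where \<rho>="\<lambda>k. \<rho> (r1 k)"]) (use \<rho> in auto)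
  obtain \<mu>' where \<mu>': "\<mu>' \<in> borel_measures_on a b" "finite_measure \<mu>'"
    "\<And>f :: real \<Rightarrow> real. continuous_on {a..b} f \<Longrightarrow> integral\<^sup>L \<mu>' f = m * integral\<^sup>L \<rho>' f"
    using borel_measures_on_scale[OF \<rho>'(1) prob_space.finite_measure[OF \<rho>'(2)], of m] m(1) by auto
  have conv: "(\<lambda>k. integral\<^sup>L (\<mu> (r1 (r2 k))) f) \<longlonglongrightarrow> integral\<^sup>L \<mu>' f"
    if "continuous_on {a..b} f" for f :: "real \<Rightarrow> real"
  proof -
    have "(\<lambda>k. ?m (r1 (r2 k)) * integral\<^sup>L (\<rho> (r1 (r2 k))) f) \<longlonglongrightarrow> m * integral\<^sup>L \<rho>' f"
      using LIMSEQ_subseq_LIMSEQ[OF m(3) r2] lim[OF that]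
      by (intro tendsto_mult) (simp_all add: comp_def)
    then show ?thesis
      using \<rho>(3)[OF that] \<mu>'(3)[OF that] by simp
  qed
  show ?thesis
  proof (rule that[of "r1 \<circ> r2" \<mu>'])
    show "strict_mono (r1 \<circ> r2)"
      using m(2) r2 by (rule strict_mono_o)
    have "integral\<^sup>L \<mu>' (g i) = c i" if "i \<le> n" for i
      using conv[OF T_plus_systemD(1)[OF T that]] moment_measuresD(3)[OF \<mu> that]
      by (simp add: LIMSEQ_const_iff)
    then show "\<mu>' \<in> moment_measures a b n g c"
      using \<mu>' T_plus_systemD(1)[OF T]
      by (auto simp: moment_measures_def has_bochner_integral_iff intro: borel_measures_on_integrable)
  qed (use conv in auto)
qed

lemma moment_measures_attain_extrema:
  assumes T: "T_plus_system a b n g" and "a < b" and h: "continuous_on {a..b} h"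
    and ne: "moment_measures a b n g c \<noteq> {}"
  obtains \<mu> \<mu>' where "\<mu> \<in> moment_measures a b n g c" "\<mu>' \<in> moment_measures a b n g c"
    "\<And>\<nu>. \<nu> \<in> moment_measures a b n g c \<Longrightarrow> integral\<^sup>L \<nu> h \<le> integral\<^sup>L \<mu> (h :: real \<Rightarrow> real)"
    "\<And>\<nu>. \<nu> \<in> moment_measures a b n g c \<Longrightarrow> integral\<^sup>L \<mu>' h \<le> integral\<^sup>L \<nu> h"
proof -
  let ?S = "(\<lambda>\<mu>. integral\<^sup>L \<mu> h) ` moment_measures a b n g c"
  have "seq_compact ?S"
    unfolding seq_compact_def
  proof (intro allI impI)
    fix y :: "nat \<Rightarrow> real" assume "\<forall>k. y k \<in> ?S"
    then have "\<forall>k. \<exists>\<mu>. \<mu> \<in> moment_measures a b n g c \<and> y k = integral\<^sup>L \<mu> h"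
      by blast
    then obtain \<mu> where \<mu>: "\<And>k. \<mu> k \<in> moment_measures a b n g c" "\<And>k. y k = integral\<^sup>L (\<mu> k) h"
      by metis
    obtain r \<mu>' where r: "strict_mono (r :: nat \<Rightarrow> nat)" and \<mu>': "\<mu>' \<in> moment_measures a b n g c"
      and lim: "\<And>f :: real \<Rightarrow> real. continuous_on {a..b} f \<Longrightarrow> (\<lambda>k. integral\<^sup>L (\<mu> (r k)) f) \<longlonglongrightarrow> integral\<^sup>L \<mu>' f"
      by (rule moment_measures_seq_compact[OF T \<open>a < b\<close>, where \<mu>=\<mu> and c=c]) (use \<mu>(1) in auto)
    with lim[OF h] show "\<exists>l\<in>?S. \<exists>r. strict_mono r \<and> (y \<circ> r) \<longlonglongrightarrow> l"
      by (auto simp: comp_def \<mu>(2))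
  qed
  then have "compact ?S"
    by (simp add: compact_eq_seq_compact_metric)
  with ne that show ?thesis
    using compact_attains_sup[of ?S] compact_attains_inf[of ?S] by auto
qed

section \<open>Adding and moving mass\<close>

lemma nn_integral_sum_measure:
  assumes sets: "sets N = sets M" "sets K = sets M"
    and em: "\<And>A. A \<in> sets M \<Longrightarrow> emeasure K A = emeasure M A + emeasure N A"
    and f: "f \<in> borel_measurable M"
  shows "(\<integral>\<^sup>+t. f t \<partial>K) = (\<integral>\<^sup>+t. f t \<partial>M) + (\<integral>\<^sup>+t. f t \<partial>N)"
proof -
  have meas: "u \<in> borel_measurable K" "u \<in> borel_measurable N"
    if "u \<in> borel_measurable M" for u :: "'a \<Rightarrow> ennreal"
    using that measurable_cong_sets[OF sets(1) refl] measurable_cong_sets[OF sets(2) refl] by auto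
  note sp = sets_eq_imp_space_eq[OF sets(1)] sets_eq_imp_space_eq[OF sets(2)]
  show ?thesis
    using f
  proof (induction rule: borel_measurable_induct)
    case (cong f g)
    have "(\<integral>\<^sup>+t. f t \<partial>L) = (\<integral>\<^sup>+t. g t \<partial>L)" if "space L = space M" for L
      using cong that by (intro nn_integral_cong) auto
    with cong sp show ?case by simp
  next
    case (set A)
    then show ?case by (simp add: em sets)
  next
    case (mult u c)
    then show ?case by (simp add: nn_integral_cmult meas distrib_left)
  next
    case (add u v)
    then show ?case by (simp add: nn_integral_add meas ac_simps)
  next
    case (seq U)
    have SUP_eq: "(SUP i. U i) = (\<lambda>t. SUP i. U i t)"
      by (rule ext) (rule SUP_apply)
    have lim: "(\<integral>\<^sup>+t. (SUP i. U i) t \<partial>L) = (SUP i. \<integral>\<^sup>+t. U i t \<partial>L)"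
      if "\<And>i. U i \<in> borel_measurable L" for L
      unfolding SUP_eq by (rule nn_integral_monotone_convergence_SUP[OF seq.hyps(3) that])
    have inc: "incseq (\<lambda>i. \<integral>\<^sup>+t. U i t \<partial>L)" for L
      using seq.hyps(3) by (auto simp: incseq_def le_fun_def intro!: nn_integral_mono)
    show ?case
      using seq.IH seq.hyps(1)
      by (simp add: lim meas ennreal_SUP_add[OF inc inc, symmetric] del: Sup_apply SUP_apply)
  qed
qed

lemma ex_sum_measure:
  assumes M: "M \<in> borel_measures_on a b" "finite_measure M"
    and N: "N \<in> borel_measures_on a b" "finite_measure N"
  obtains K where "K \<in> borel_measures_on a b" "finite_measure K"
    "\<And>f :: real \<Rightarrow> real. continuous_on {a..b} f \<Longrightarrow> integral\<^sup>L K f = integral\<^sup>L M f + integral\<^sup>L N f"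
proof -
  define K where "K = measure_of (space M) (sets M) (\<lambda>A. emeasure M A + emeasure N A)"
  have sets_N: "sets N = sets M"
    using borel_measures_onD[OF M(1)] borel_measures_onD[OF N(1)] by simp
  have sets_K: "sets K = sets M"
    by (simp add: K_def)
  have em: "emeasure K A = emeasure M A + emeasure N A" if "A \<in> sets M" for A
    unfolding K_def
  proof (rule emeasure_measure_of_sigma[OF sets.sigma_algebra_axioms _ _ that])
    show "positive (sets M) (\<lambda>A. emeasure M A + emeasure N A)"
      by (simp add: positive_def)
    show "countably_additive (sets M) (\<lambda>A. emeasure M A + emeasure N A)"
    proof (rule countably_additiveI)
      fix F :: "nat \<Rightarrow> real set" assume F: "range F \<subseteq> sets M" "disjoint_family F"
      then have "range F \<subseteq> sets N" using sets_N by simp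
      with F show "(\<Sum>i. emeasure M (F i) + emeasure N (F i)) =
          emeasure M (\<Union> (range F)) + emeasure N (\<Union> (range F))"
        by (subst suminf_add[symmetric]) (auto simp: suminf_emeasure)
    qed
  qed
  have K: "K \<in> borel_measures_on a b"
    using M(1) sets_K by (simp add: borel_measures_on_def)
  have fin: "finite_measure K"
    using borel_measures_onD(2)[OF K] em[of "{a..b}"] borel_measures_on_sets[OF M(1)]
      finite_measure.emeasure_finite[OF M(2)] finite_measure.emeasure_finite[OF N(2)]
    by (intro finite_measureI) simp
  show ?thesis
  proof (rule that[OF K fin])
    fix f :: "real \<Rightarrow> real" assume f: "continuous_on {a..b} f"
    have nn: "(\<integral>\<^sup>+t. ennreal (h t) \<partial>K) = (\<integral>\<^sup>+t. ennreal (h t) \<partial>M) + (\<integral>\<^sup>+t. ennreal (h t) \<partial>N)"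
      if "h \<in> borel_measurable M" for h
      using that by (intro nn_integral_sum_measure[OF sets_N sets_K em]) auto
    have int: "integrable L f" if "L \<in> borel_measures_on a b" "finite_measure L" for L
      using borel_measures_on_integrable[OF that f] .
    have fin_int: "(\<integral>\<^sup>+t. ennreal (f t) \<partial>L) < Orderings.top" "(\<integral>\<^sup>+t. ennreal (- f t) \<partial>L) < Orderings.top"
      if "integrable L f" for L
      using that by (auto simp: real_integrable_def less_top)
    show "integral\<^sup>L K f = integral\<^sup>L M f + integral\<^sup>L N f"
      using nn[of f] nn[of "\<lambda>t. - f t"] borel_measures_on_measurable[OF M(1) f]
        int[OF M] int[OF N] int[OF K fin]
      by (simp add: real_lebesgue_integral_def fin_int enn2real_plus)
  qed
qed

text \<open>Coefficients on \<open>P\<close> may be negative, because there they rescale mass that \<open>\<nu>\<close> already has on \<open>J\<^sub>j\<close>.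
Coefficients on \<open>Q\<close> add new atoms and must be nonnegative. A small enough \<open>e\<close> keeps the rescaled
density nonnegative even where the sets \<open>J\<^sub>j\<close> overlap.\<close>

lemma perturb_measure:
  fixes l x :: "nat \<Rightarrow> real"
  assumes \<nu>: "\<nu> \<in> borel_measures_on a b" "finite_measure \<nu>"
    and "finite P" "finite Q"
    and J: "\<And>j. j \<in> P \<Longrightarrow> J j \<in> sets \<nu>"
    and x: "\<And>j. j \<in> Q \<Longrightarrow> x j \<in> {a..b}" and l: "\<And>j. j \<in> Q \<Longrightarrow> l j \<ge> 0"
  obtains e \<nu>' where "e > 0" "\<nu>' \<in> borel_measures_on a b" "finite_measure \<nu>'"
    "\<And>f :: real \<Rightarrow> real. continuous_on {a..b} f \<Longrightarrow> integral\<^sup>L \<nu>' f =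
      integral\<^sup>L \<nu> f + e * ((\<Sum>j\<in>P. l j * (\<integral>t. indicator (J j) t * f t \<partial>\<nu>)) + (\<Sum>j\<in>Q. l j * f (x j)))"
proof -
  define e where "e = 1 / (1 + (\<Sum>j\<in>P. \<bar>l j\<bar>))"
  have s: "(\<Sum>j\<in>P. \<bar>l j\<bar>) \<ge> 0" by (intro sum_nonneg) auto
  then have s': "1 + (\<Sum>j\<in>P. \<bar>l j\<bar>) > 0" by linarith
  then have "e > 0" by (simp add: e_def)
  define w where "w t = 1 + e * (\<Sum>j\<in>P. l j * indicator (J j) t)" for t
  have w_nonneg: "w t \<ge> 0" for t
  proof -
    have "\<bar>\<Sum>j\<in>P. l j * indicator (J j) t\<bar> \<le> (\<Sum>j\<in>P. \<bar>l j * indicator (J j) t\<bar>)"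
      by (rule sum_abs)
    also have "\<dots> \<le> (\<Sum>j\<in>P. \<bar>l j\<bar>)"
      by (intro sum_mono) (auto simp: indicator_def)
    finally have "e * \<bar>\<Sum>j\<in>P. l j * indicator (J j) t\<bar> \<le> e * (\<Sum>j\<in>P. \<bar>l j\<bar>)"
      using \<open>e > 0\<close> by (intro mult_left_mono) auto
    also have "\<dots> \<le> 1" using s' by (simp add: e_def)
    finally have "\<bar>e * (\<Sum>j\<in>P. l j * indicator (J j) t)\<bar> \<le> 1"
      using \<open>e > 0\<close> by (simp add: abs_mult)
    then show ?thesis by (simp add: w_def abs_le_iff)
  qed
  have w_meas: "w \<in> borel_measurable \<nu>"
    unfolding w_def using J by measurable
  define \<nu>1 where "\<nu>1 = density \<nu> (\<lambda>t. ennreal (w t))"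
  have int1: "integral\<^sup>L \<nu>1 f = integral\<^sup>L \<nu> f + e * (\<Sum>j\<in>P. l j * (\<integral>t. indicator (J j) t * f t \<partial>\<nu>))"
    if "f \<in> borel_measurable \<nu>" "integrable \<nu> f" for f
  proof -
    have int: "integrable \<nu> (\<lambda>t. indicator (J j) t * f t)" if "j \<in> P" for j
      using integrable_real_mult_indicator[OF J[OF that] \<open>integrable \<nu> f\<close>] by (simp add: mult.commute)
    have "integral\<^sup>L \<nu>1 f = (\<integral>t. w t * f t \<partial>\<nu>)"
      unfolding \<nu>1_def using w_meas w_nonneg that by (subst integral_density) auto
    also have "\<dots> = (\<integral>t. f t + e * (\<Sum>j\<in>P. l j * (indicator (J j) t * f t)) \<partial>\<nu>)"
      by (simp add: w_def distrib_right sum_distrib_right mult.assoc)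
    also have "\<dots> = integral\<^sup>L \<nu> f + e * (\<Sum>j\<in>P. l j * (\<integral>t. indicator (J j) t * f t \<partial>\<nu>))"
      using that(2) int by simp
    finally show ?thesis .
  qed
  have \<nu>1: "\<nu>1 \<in> borel_measures_on a b"
    using \<nu>(1) by (simp add: \<nu>1_def borel_measures_on_def)
  have fin1: "finite_measure \<nu>1"
  proof (rule finite_measureI)
    interpret finite_measure \<nu> by fact
    have "integrable \<nu> w"
      unfolding w_def using J
      by (intro Bochner_Integration.integrable_add integrable_mult_right Bochner_Integration.integrable_sum integrable_real_indicator)
         (auto simp: emeasure_eq_measure)
    then have "(\<integral>\<^sup>+t. ennreal (w t) \<partial>\<nu>) < \<infinity>"
      using w_nonneg by (simp add: integrable_iff_bounded)
    moreover have "emeasure \<nu>1 (space \<nu>1) = (\<integral>\<^sup>+t. ennreal (w t) \<partial>\<nu>)"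
      unfolding \<nu>1_def space_density using w_meas
      by (subst emeasure_density) (auto intro!: nn_integral_cong)
    ultimately show "emeasure \<nu>1 (space \<nu>1) \<noteq> \<infinity>" by simp
  qed
  define \<nu>2 where "\<nu>2 = distr (point_measure Q (\<lambda>j. ennreal (e * l j))) (restrict_space borel {a..b}) x"
  have x_meas: "x \<in> measurable (point_measure Q (\<lambda>j. ennreal (e * l j))) (restrict_space borel {a..b})"
    using x by (simp add: space_restrict_space)
  have \<nu>2: "\<nu>2 \<in> borel_measures_on a b"
    by (simp add: \<nu>2_def borel_measures_on_def)
  have fin2: "finite_measure \<nu>2"
    unfolding \<nu>2_def using \<open>finite Q\<close>
    by (intro finite_measure.finite_measure_distr x_meas finite_measureI)
       (simp add: emeasure_point_measure_finite space_point_measure)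
  have int2: "integral\<^sup>L \<nu>2 f = e * (\<Sum>j\<in>Q. l j * f (x j))" if "continuous_on {a..b} f" for f
    unfolding \<nu>2_def using l \<open>e > 0\<close> \<open>finite Q\<close>
    by (subst integral_distr[OF x_meas borel_measurable_continuous_on_restrict[OF that]])
       (simp add: lebesgue_integral_point_measure_finite sum_distrib_left mult.assoc)
  obtain K where K: "K \<in> borel_measures_on a b" "finite_measure K"
    "\<And>f :: real \<Rightarrow> real. continuous_on {a..b} f \<Longrightarrow> integral\<^sup>L K f = integral\<^sup>L \<nu>1 f + integral\<^sup>L \<nu>2 f"
    by (rule ex_sum_measure[OF \<nu>1 fin1 \<nu>2 fin2]) auto
  show ?thesis
    by (rule that[OF \<open>e > 0\<close> K(1,2)])
       (simp add: K(3) int1 int2 borel_measures_on_measurable[OF \<nu>(1)] borel_measures_on_integrable[OF \<nu>] distrib_left)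
qed

text \<open>Removing mass near the points \<open>x\<^sub>j\<close> with \<open>j \<in> P\<close> and adding mass at the points between them keeps the
moments of \<open>g\<^sub>0, \<dots>, g\<^sub>n\<close> and moves the integral of \<open>g\<^sub>n\<^sub>+\<^sub>1\<close> strictly, by
\<open>alternating_coefficients\<close>. To increase the integral (\<open>B\<close>), mass is removed at \<open>x\<^sub>n, x\<^sub>n\<^sub>-\<^sub>2, \<dots>\<close>;
to decrease it, the signs are reversed and mass is removed at \<open>x\<^sub>n\<^sub>+\<^sub>1, x\<^sub>n\<^sub>-\<^sub>1, \<dots>\<close>. Removal is
possible when these points are in the support.\<close>

lemma moment_measures_perturb:
  assumes Tn: "T_plus_system a b n g" and Tn1: "T_plus_system a b (n + 1) g" and "a < b"
    and \<nu>: "\<nu> \<in> moment_measures a b n g c"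
    and x: "strict_mono_on {..n+1} x" "x ` {..n+1} \<subseteq> {a..b}"
    and P: "P = {j. j \<le> n + 1 \<and> (even (n + 1 + j) \<longleftrightarrow> \<not> B)}" "x ` P \<subseteq> measure_support \<nu>"
  obtains \<nu>' where "\<nu>' \<in> moment_measures a b n g c"
    "if B then integral\<^sup>L \<nu>' (g (n + 1)) > integral\<^sup>L \<nu> (g (n + 1))
     else integral\<^sup>L \<nu>' (g (n + 1)) < integral\<^sup>L \<nu> (g (n + 1))"
proof -
  note \<nu>0 = moment_measuresD(1)[OF \<nu>] moment_measures_finite[OF Tn \<open>a < b\<close> \<nu>]
  define Q where "Q = {..n+1} - P"
  have PQ: "finite P" "finite Q" "P \<union> Q = {..n+1}" "P \<inter> Q = {}" "\<And>j. j \<in> P \<Longrightarrow> j \<le> n + 1" "\<And>j. j \<in> Q \<Longrightarrow> j \<le> n + 1"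
    by (auto simp: P(1) Q_def)
  \<comment> \<open>Half the smallest gap, so that the \<open>e\<close>-neighbourhoods of the points are separated.\<close>
  define e where "e = Min ((\<lambda>j. (x (Suc j) - x j) / 2) ` {..n})"
  have "e > 0"
    unfolding e_def using x(1) by (subst Min_gr_iff) (auto simp: strict_mono_on_def)
  have gap: "x j + e \<le> x (Suc j) - e" if "j \<le> n" for j
  proof -
    have "e \<le> (x (Suc j) - x j) / 2"
      unfolding e_def using that by (intro Min_le) auto
    then show ?thesis by (simp add: field_simps)
  qed
  define J where "J j = {a..b} \<inter> {x j - e<..<x j + e}" for j
  have J_sets: "J j \<in> sets \<nu>" for j
    by (auto simp: J_def borel_measures_on_sets[OF \<nu>0(1)])
  have sep: "s < t" if "i < j" "j \<le> n + 1" "s \<in> J i" "t \<in> J j" for i j s t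
  proof -
    have "s < x i + e" "x j - e < t"
      using that by (auto simp: J_def)
    moreover have "x (Suc i) \<le> x j"
      using x(1) that by (cases "Suc i = j") (auto simp: strict_mono_on_def less_imp_le)
    ultimately show ?thesis using gap[of i] that by linarith
  qed
  have xab: "x j \<in> {a..b}" if "j \<le> n + 1" for j
    using x(2) that by auto
  define \<kappa> where "\<kappa> j = (if j \<in> P then density \<nu> (indicator (J j)) else return (restrict_space borel {a..b}) (x j))" for j
  note D = density_indicator[OF \<nu>0 J_sets]
  have \<kappa>_P: "\<kappa> j = density \<nu> (indicator (J j))" if "j \<in> P" for j
    using that by (simp add: \<kappa>_def)
  have \<kappa>_Q: "\<kappa> j = return (restrict_space borel {a..b}) (x j)" if "j \<in> Q" for j
    using that by (simp add: \<kappa>_def Q_def)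
  have cases: "j \<in> P \<or> j \<in> Q" if "j \<le> n + 1" for j
    using that by (auto simp: Q_def)
  have \<kappa>_all: "\<kappa> j \<in> borel_measures_on a b \<and> finite_measure (\<kappa> j) \<and> (AE t in \<kappa> j. t \<in> J j) \<and> emeasure (\<kappa> j) {a..b} \<noteq> 0"
    if j: "j \<le> n + 1" for j
  proof (cases "j \<in> P")
    case True
    have "emeasure \<nu> (J j) > 0"
      using P(2) True \<open>e > 0\<close>
      by (intro emeasure_support_pos[OF \<nu>0(1) _ _ _ _ J_sets, of "x j" "{x j - e<..<x j + e}"])
         (auto simp: J_def)
    then show ?thesis
      unfolding \<kappa>_P[OF True] D(4) using D(1-3)[of j] by auto
  next
    case False
    then have "j \<in> Q" using cases j by blast
    note \<delta> = dirac_borel_measures_on[OF xab[OF j]]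
    have "AE t in \<kappa> j. t \<in> J j"
      unfolding \<kappa>_Q[OF \<open>j \<in> Q\<close>] using xab[OF j] \<open>e > 0\<close> by (intro \<delta>(4)) (auto simp: J_def)
    moreover have "emeasure (\<kappa> j) {a..b} \<noteq> 0"
      using prob_space.emeasure_space_1[OF \<delta>(2)] borel_measures_onD(2)[OF \<delta>(1)]
      by (simp only: \<kappa>_Q[OF \<open>j \<in> Q\<close>]) simp
    ultimately show ?thesis
      using \<delta>(1) prob_space.finite_measure[OF \<delta>(2)] by (simp add: \<kappa>_Q[OF \<open>j \<in> Q\<close>])
  qed
  then have \<kappa>: "\<And>j. j \<le> n + 1 \<Longrightarrow> \<kappa> j \<in> borel_measures_on a b"
    "\<And>j. j \<le> n + 1 \<Longrightarrow> finite_measure (\<kappa> j)"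
    "\<And>j. j \<le> n + 1 \<Longrightarrow> AE t in \<kappa> j. t \<in> J j"
    "\<And>j. j \<le> n + 1 \<Longrightarrow> emeasure (\<kappa> j) {a..b} \<noteq> 0"
    by blast+
  have J_sub: "J j \<subseteq> {a..b}" for j by (auto simp: J_def)
  obtain l0 where l0: "\<And>j. j \<le> n + 1 \<Longrightarrow> (-1) ^ (n + 1 + j) * l0 j > 0"
    "\<And>i. i \<le> n \<Longrightarrow> (\<Sum>j\<le>n+1. l0 j * integral\<^sup>L (\<kappa> j) (g i)) = 0"
    "(\<Sum>j\<le>n+1. l0 j * integral\<^sup>L (\<kappa> j) (g (n + 1))) > 0"
    by (rule alternating_coefficients[OF Tn Tn1 \<kappa> sep J_sub]) blast+
  define l where "l j = (if B then l0 j else - l0 j)" for j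
  have l: "l j \<ge> 0" if "j \<in> Q" for j
  proof -
    have "j \<le> n + 1" "even (n + 1 + j) \<longleftrightarrow> B"
      using that by (auto simp: Q_def P(1))
    with l0(1)[of j] show ?thesis
      by (cases "even (n + 1 + j)") (auto simp: l_def)
  qed
  obtain d \<nu>' where "d > 0" and \<nu>': "\<nu>' \<in> borel_measures_on a b" "finite_measure \<nu>'"
    and int: "\<And>f :: real \<Rightarrow> real. continuous_on {a..b} f \<Longrightarrow> integral\<^sup>L \<nu>' f =
      integral\<^sup>L \<nu> f + d * ((\<Sum>j\<in>P. l j * (\<integral>t. indicator (J j) t * f t \<partial>\<nu>)) + (\<Sum>j\<in>Q. l j * f (x j)))"
    by (rule perturb_measure[OF \<nu>0 PQ(1,2), where J=J and x=x and l=l]) (use J_sets xab PQ(6) l in blast)+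
  have int': "integral\<^sup>L \<nu>' f = integral\<^sup>L \<nu> f + d * (\<Sum>j\<le>n+1. l j * integral\<^sup>L (\<kappa> j) f)"
    if f: "continuous_on {a..b} f" for f
  proof -
    have "(\<Sum>j\<le>n+1. l j * integral\<^sup>L (\<kappa> j) f) =
      (\<Sum>j\<in>P. l j * integral\<^sup>L (\<kappa> j) f) + (\<Sum>j\<in>Q. l j * integral\<^sup>L (\<kappa> j) f)"
      unfolding PQ(3)[symmetric] using PQ by (intro sum.union_disjoint) auto
    also have "(\<Sum>j\<in>P. l j * integral\<^sup>L (\<kappa> j) f) = (\<Sum>j\<in>P. l j * (\<integral>t. indicator (J j) t * f t \<partial>\<nu>))"
      using D(5)[OF f] by (intro sum.cong) (simp_all add: \<kappa>_P)
    also have "(\<Sum>j\<in>Q. l j * integral\<^sup>L (\<kappa> j) f) = (\<Sum>j\<in>Q. l j * f (x j))"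
      using dirac_borel_measures_on(3)[OF xab f] PQ(6) by (intro sum.cong) (simp_all add: \<kappa>_Q)
    finally show ?thesis using int[OF f] by simp
  qed
  have sum_l: "(\<Sum>j\<le>n+1. l j * integral\<^sup>L (\<kappa> j) f) = (if B then 1 else -1) * (\<Sum>j\<le>n+1. l0 j * integral\<^sup>L (\<kappa> j) f)" for f
    by (simp add: l_def sum_negf)
  show ?thesis
  proof (rule that[of \<nu>'])
    have "integral\<^sup>L \<nu>' (g i) = c i" if "i \<le> n" for i
      using int'[OF T_plus_systemD(1)[OF Tn that]] sum_l l0(2)[OF that] moment_measuresD(3)[OF \<nu> that]
      by simp
    then show "\<nu>' \<in> moment_measures a b n g c"
      using \<nu>' T_plus_systemD(1)[OF Tn]
      by (auto simp: moment_measures_def has_bochner_integral_iff intro: borel_measures_on_integrable)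
    define S where "S = (\<Sum>j\<le>n+1. l0 j * integral\<^sup>L (\<kappa> j) (g (n + 1)))"
    have "d * S > 0"
      using l0(3) \<open>d > 0\<close> by (simp only: S_def[symmetric]) simp
    moreover have "integral\<^sup>L \<nu>' (g (n + 1)) =
        integral\<^sup>L \<nu> (g (n + 1)) + d * ((if B then 1 else -1) * S)"
      unfolding S_def sum_l[symmetric] by (rule int'[OF T_plus_systemD(1)[OF Tn1 order_refl]])
    ultimately show "if B then integral\<^sup>L \<nu>' (g (n + 1)) > integral\<^sup>L \<nu> (g (n + 1))
     else integral\<^sup>L \<nu>' (g (n + 1)) < integral\<^sup>L \<nu> (g (n + 1))"
      by (cases B) simp_all
  qed
qed

section \<open>Supports of extremal measures\<close>

text \<open>Midpoints go between consecutive \<open>y\<^sub>i\<close>, and each endpoint of the interval that belongs to \<open>E\<close>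
contributes one more point outside the \<open>y\<^sub>i\<close>; this is why the \<open>y\<^sub>i\<close> must avoid \<open>E\<close>. The count is
\<open>(q + 1) + q + card E\<close>, so the last index is \<open>2 q + card E\<close>.\<close>

lemma ex_interlacing_points:
  fixes a b :: real and y :: "nat \<Rightarrow> real" and q :: nat
  assumes y: "strict_mono_on {..q} y" "y ` {..q} \<subseteq> {a..b} - E"
    and E: "E = (if A then {a} else {}) \<union> (if B then {b} else {})"
  obtains x where "strict_mono_on {..2 * q + of_bool A + of_bool B} x"
    "x ` {..2 * q + of_bool A + of_bool B} \<subseteq> {a..b}"
    "\<And>j. j \<le> 2 * q + of_bool A + of_bool B \<Longrightarrow> even (of_bool A + j) \<Longrightarrow> x j \<in> y ` {..q}"
proof -
  \<comment> \<open>The points \<open>y i\<close> get the indices \<open>s + 2 * i\<close>, shifted by one if \<open>a\<close> comes first.\<close>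
  define s :: nat where "s = of_bool A"
  define N where "N = 2 * q + s + of_bool B"
  define x where "x j = (if j < s then a else if even (j - s) then y ((j - s) div 2)
    else if (j - s) div 2 < q then (y ((j - s) div 2) + y (Suc ((j - s) div 2))) / 2 else b)" for j
  have x_even: "x (s + 2 * i) = y i" for i by (simp add: x_def)
  have x_odd: "x (s + 2 * i + 1) = (if i < q then (y i + y (Suc i)) / 2 else b)" for i
    by (simp add: x_def)
  have yab: "y i \<in> {a..b} - E" if "i \<le> q" for i
    using y(2) that by auto
  have y_less: "y i < y (Suc i)" if "i < q" for i
    using y(1) that by (auto simp: strict_mono_on_def)
  have dec: "j < s \<or> (\<exists>i. j = s + 2 * i) \<or> (\<exists>i. j = s + 2 * i + 1)" for j
  proof (cases "j < s")
    case False
    then obtain k where "j = s + k" using le_Suc_ex by (metis not_le)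
    then show ?thesis
      by (cases "even k") (auto elim!: evenE oddE)
  qed simp
  have B_le: "of_bool B \<le> (1::nat)" by simp
  have step: "x j < x (Suc j)" if "j < N" for j
    using dec[of j]
  proof (elim disjE exE)
    assume "j < s"
    then have "A" "s = 1" "j = 0" by (cases A; simp add: s_def)+
    then have "a \<in> E" by (simp add: E)
    with yab[of 0] have "a < y 0" by (metis Diff_iff atLeastAtMost_iff order_le_less zero_le)
    then show ?thesis using \<open>s = 1\<close> \<open>j = 0\<close> x_even[of 0] by (simp add: x_def)
  next
    fix i assume j: "j = s + 2 * i"
    show ?thesis
    proof (cases "i < q")
      case True
      then show ?thesis using y_less[OF True] x_even[of i] x_odd[of i] j by simp
    next
      case False
      then have "B" "i = q" using that j by (cases B; simp add: N_def)+
      then have "b \<in> E" by (simp add: E)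
      with yab[of q] have "y q < b" by (metis Diff_iff atLeastAtMost_iff order_le_less order_refl)
      then show ?thesis using x_even[of i] x_odd[of i] j \<open>i = q\<close> by simp
    qed
  next
    fix i assume j: "j = s + 2 * i + 1"
    then have "i < q" using that B_le unfolding N_def by linarith
    moreover have "Suc j = s + 2 * Suc i" using j by simp
    ultimately show ?thesis using y_less[OF \<open>i < q\<close>] x_even[of "Suc i"] x_odd[of i] j by simp
  qed
  have mono: "strict_mono_on {..N} x"
  proof (rule strict_mono_onI)
    fix i j assume ij: "i \<in> {..N}" "j \<in> {..N}" "i < j"
    have "x i < x (i + Suc k)" if "i + Suc k \<le> N" for k
      using that
    proof (induction k)
      case (Suc k)
      then have "x i < x (i + Suc k)" "x (i + Suc k) < x (Suc (i + Suc k))"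
        by (auto intro: step)
      then show ?case by simp
    qed (use step in auto)
    from this[of "j - Suc i"] ij show "x i < x j" by simp
  qed
  have in_ab: "x j \<in> {a..b}" if "j \<le> N" for j
    using dec[of j]
  proof (elim disjE exE)
    assume "j < s"
    then show ?thesis using yab[of 0] by (simp add: x_def)
  next
    fix i assume j: "j = s + 2 * i"
    then have "i \<le> q" using that B_le unfolding N_def by linarith
    then show ?thesis using yab x_even j by auto
  next
    fix i assume j: "j = s + 2 * i + 1"
    show ?thesis
    proof (cases "i < q")
      case True
      then show ?thesis using yab[of i] yab[of "Suc i"] x_odd[of i] j by simp
    next
      case False
      then show ?thesis using yab[of 0] x_odd[of i] j by simp
    qed
  qed
  have "x j \<in> y ` {..q}" if "j \<le> N" "even (s + j)" for j
    using dec[of j]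
  proof (elim disjE exE)
    assume "j < s"
    then have "s = 1" "j = 0" by (cases A; simp add: s_def)+
    with that show ?thesis by simp
  next
    fix i assume j: "j = s + 2 * i"
    then have "i \<le> q" using that B_le unfolding N_def by linarith
    then show ?thesis using x_even j by auto
  next
    fix i assume "j = s + 2 * i + 1"
    with that show ?thesis by simp
  qed
  with mono in_ab show ?thesis
    by (intro that[of x]) (auto simp: N_def s_def)
qed

text \<open>With more than \<open>q\<close> support points off \<open>E\<close>, one could place \<open>n + 2 = 2 q + 1 + card E\<close> points such
that all those at which the perturbation removes mass are in the support, and the integral could be
improved. The flag \<open>B\<close> selects maximization, where the last of the \<open>n + 2\<close> points receives mass and so
has to lie to the right of the support points; this needs room before \<open>b\<close>, hence \<open>b \<in> E\<close>. The flag \<open>A\<close> is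
then dictated by the parity of \<open>n\<close>.\<close>

lemma extremal_support:
  assumes Tn: "T_plus_system a b n g" and Tn1: "T_plus_system a b (n + 1) g" and "a < b"
    and \<nu>: "\<nu> \<in> moment_measures a b n g c"
    and q: "n + 1 = 2 * (q :: nat) + of_bool A + of_bool B"
    and E: "E = (if A then {a} else {}) \<union> (if B then {b} else {})"
    and ext: "\<And>\<nu>'. \<nu>' \<in> moment_measures a b n g c \<Longrightarrow>
      (if B then integral\<^sup>L \<nu>' (g (n + 1)) \<le> integral\<^sup>L \<nu> (g (n + 1))
       else integral\<^sup>L \<nu> (g (n + 1)) \<le> integral\<^sup>L \<nu>' (g (n + 1)))"
  shows "finite (measure_support \<nu>) \<and> card (measure_support \<nu> - E) \<le> q"
proof (rule ccontr)
  let ?S = "measure_support \<nu> - E"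
  assume neg: "\<not> ?thesis"
  have "finite E" by (simp add: E)
  have "\<exists>Y. Y \<subseteq> ?S \<and> finite Y \<and> card Y = q + 1"
  proof (cases "finite ?S")
    case True
    then have "finite (measure_support \<nu>)" using \<open>finite E\<close> by simp
    with neg have "q + 1 \<le> card ?S" by simp
    from obtain_subset_with_card_n[OF this] show ?thesis by metis
  next
    case False
    then show ?thesis using infinite_arbitrarily_large by blast
  qed
  then obtain Y where Y: "Y \<subseteq> ?S" "finite Y" "card Y = q + 1" by blast
  then obtain y where y: "strict_mono_on {..q} y" "y ` {..q} = Y"
    using ex_strict_mono_enumeration by blast
  have y_sub: "y ` {..q} \<subseteq> {a..b} - E"
    using y(2) Y(1) measure_support_subset[OF moment_measuresD(1)[OF \<nu>]] by blast
  obtain x where x: "strict_mono_on {..n+1} x" "x ` {..n+1} \<subseteq> {a..b}"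
    "\<And>j. j \<le> n + 1 \<Longrightarrow> even (of_bool A + j) \<Longrightarrow> x j \<in> y ` {..q}"
    by (rule ex_interlacing_points[OF y(1) y_sub E, folded q]) blast+
  define P where "P = {j. j \<le> n + 1 \<and> (even (n + 1 + j) \<longleftrightarrow> \<not> B)}"
  have "x j \<in> measure_support \<nu>" if "j \<in> P" for j
  proof -
    have "even (of_bool A + j)"
      using that unfolding P_def q by (cases A; cases B) auto
    then show ?thesis using x(3) that y(2) Y(1) by (auto simp: P_def)
  qed
  then have xP: "x ` P \<subseteq> measure_support \<nu>" by blast
  obtain \<nu>' where "\<nu>' \<in> moment_measures a b n g c"
    "if B then integral\<^sup>L \<nu>' (g (n + 1)) > integral\<^sup>L \<nu> (g (n + 1))
     else integral\<^sup>L \<nu>' (g (n + 1)) < integral\<^sup>L \<nu> (g (n + 1))"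
    using moment_measures_perturb[OF Tn Tn1 \<open>a < b\<close> \<nu> x(1,2) P_def xP] .
  with ext[of \<nu>'] show False by (auto split: if_splits)
qed

text \<open>Two such measures together occupy at most \<open>q + q + card E\<close> points, which is no more than the number
of moments that they share. The shape of the support is stated in terms of \<open>E\<close> and \<open>q\<close> alone, so the
measure is the same for every function that is optimized.\<close>

lemma principal_measure_unique:
  assumes T: "T_plus_system a b n g" and "a < b"
    and \<mu>: "\<mu> \<in> moment_measures a b n g c" "finite (measure_support \<mu>)" "card (measure_support \<mu> - E) \<le> q"
    and \<nu>: "\<nu> \<in> moment_measures a b n g c" "finite (measure_support \<nu>)" "card (measure_support \<nu> - E) \<le> q"
    and E: "finite E" "E \<subseteq> {a..b}" "2 * q + card E \<le> n + 1"
  shows "\<mu> = \<nu>"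
proof -
  let ?F = "((measure_support \<mu> - E) \<union> (measure_support \<nu> - E)) \<union> E"
  have "card ?F \<le> card (measure_support \<mu> - E) + card (measure_support \<nu> - E) + card E"
    using card_Un_le[of "(measure_support \<mu> - E) \<union> (measure_support \<nu> - E)" E]
      card_Un_le[of "measure_support \<mu> - E" "measure_support \<nu> - E"] by linarith
  then have "card ?F \<le> n + 1" using \<mu>(3) \<nu>(3) E(3) by linarith
  then show ?thesis
    using \<mu>(1,2) \<nu>(1,2) E moment_measuresD[OF \<mu>(1)] moment_measuresD[OF \<nu>(1)]
      measure_support_subset[OF moment_measuresD(1)[OF \<mu>(1)]]
      measure_support_subset[OF moment_measuresD(1)[OF \<nu>(1)]]
    by (intro moments_determine_finite_support[OF T \<open>a < b\<close>, of \<mu> \<nu> ?F]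
        moment_measures_finite[OF T \<open>a < b\<close>]) auto
qed

lemma T_plus_system_cong:
  assumes "\<And>i. i \<le> k \<Longrightarrow> g' i = g i" "T_plus_system a b k g"
  shows "T_plus_system a b k g'"
proof -
  have "Matrix.mat (k + 1) (k + 1) (\<lambda>(i, j). g' i (x j)) = Matrix.mat (k + 1) (k + 1) (\<lambda>(i, j). g i (x j))"
    for x :: "nat \<Rightarrow> real"
    by (rule cong_mat) (auto simp: assms(1))
  with assms show ?thesis by (simp add: T_plus_system_def)
qed

lemma moment_measures_cong:
  assumes "\<And>i. i \<le> n \<Longrightarrow> g i = g' i"
  shows "moment_measures a b n g c = moment_measures a b n g' c"
  using assms by (auto simp: moment_measures_def)

text \<open>The maximum and the minimum are treated at once: \<open>B\<close> says which of the two is meant, and \<open>E\<close> is the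
set of endpoints that the extremal measure may charge in addition to \<open>q\<close> other points. Every optimal
measure has a support of that shape, only one measure in the moment class has, and an optimal measure
exists, so optimality characterizes this measure for each admissible \<open>h\<close>.\<close>

lemma principal_measure:
  assumes Tn: "T_plus_system a b n g" and "a < b"
    and ne: "moment_measures a b n g c \<noteq> {}"
    and h0: "T_plus_system a b (n + 1) (g(n + 1 := h0))"
    and q: "n + 1 = 2 * (q :: nat) + of_bool A + of_bool B"
    and E: "E = (if A then {a} else {}) \<union> (if B then {b} else {})"
  defines "opt \<equiv> if B then unique_maximizer else unique_minimizer"
  obtains \<mu> X where "\<mu> \<in> moment_measures a b n g c"
    "\<And>h. T_plus_system a b (n + 1) (g(n + 1 := h)) \<Longrightarrow> opt (moment_measures a b n g c) h \<mu>"
    "measure_support \<mu> \<subseteq> X" "X \<subseteq> {a..b}" "E \<subseteq> X" "card X = q + card E"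
proof -
  let ?N = "moment_measures a b n g c"
  define is_opt where "is_opt h \<mu> \<longleftrightarrow> \<mu> \<in> ?N \<and> (\<forall>\<nu>\<in>?N.
    if B then integral\<^sup>L \<nu> h \<le> integral\<^sup>L \<mu> h else integral\<^sup>L \<mu> h \<le> integral\<^sup>L \<nu> h)" for h :: "real \<Rightarrow> real" and \<mu>
  define principal where "principal \<mu> \<longleftrightarrow> \<mu> \<in> ?N \<and> finite (measure_support \<mu>) \<and> card (measure_support \<mu> - E) \<le> q" for \<mu>
  have E_fin: "finite E" and E_sub: "E \<subseteq> {a..b}" and E_card: "card E = of_bool A + of_bool B"
    using \<open>a < b\<close> by (auto simp: E)
  have cont: "continuous_on {a..b} h" if "T_plus_system a b (n + 1) (g(n + 1 := h))" for h
    using T_plus_systemD(1)[OF that order_refl] by simp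
  have T': "T_plus_system a b n (g(n + 1 := h))" for h
    by (rule T_plus_system_cong[OF _ Tn]) simp
  have N': "moment_measures a b n (g(n + 1 := h)) c = ?N" for h
    by (rule moment_measures_cong) simp
  have ex: "\<exists>\<mu>. is_opt h \<mu>" if T: "T_plus_system a b (n + 1) (g(n + 1 := h))" for h
  proof -
    obtain \<mu> \<mu>' where "\<mu> \<in> ?N" "\<mu>' \<in> ?N" "\<And>\<nu>. \<nu> \<in> ?N \<Longrightarrow> integral\<^sup>L \<nu> h \<le> integral\<^sup>L \<mu> h"
      "\<And>\<nu>. \<nu> \<in> ?N \<Longrightarrow> integral\<^sup>L \<mu>' h \<le> integral\<^sup>L \<nu> h"
      by (rule moment_measures_attain_extrema[OF Tn \<open>a < b\<close> cont[OF T] ne]) auto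
    then show ?thesis by (cases B) (auto simp: is_opt_def)
  qed
  have pr: "principal \<mu>" if "T_plus_system a b (n + 1) (g(n + 1 := h))" "is_opt h \<mu>" for h \<mu>
  proof -
    have "finite (measure_support \<mu>) \<and> card (measure_support \<mu> - E) \<le> q"
    proof (rule extremal_support[OF T' that(1) \<open>a < b\<close> _ q E])
      show "\<mu> \<in> moment_measures a b n (g(n + 1 := h)) c"
        unfolding N' using that(2) by (simp add: is_opt_def)
    qed (use that(2) in \<open>simp add: N'[unfolded Suc_eq_plus1[symmetric]] is_opt_def\<close>)
    then show ?thesis using that(2) by (simp add: principal_def is_opt_def)
  qed
  have uniq: "\<mu> = \<nu>" if "principal \<mu>" "principal \<nu>" for \<mu> \<nu>
    using that q
    by (intro principal_measure_unique[OF Tn \<open>a < b\<close> _ _ _ _ _ _ E_fin E_sub, where q=q and c=c])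
       (simp_all add: principal_def E_card)
  obtain \<mu> where \<mu>: "is_opt h0 \<mu>" using ex[OF h0] by blast
  note pr\<mu> = pr[OF h0 \<mu>]
  have iff: "is_opt h \<nu> \<longleftrightarrow> \<nu> = \<mu>" if "T_plus_system a b (n + 1) (g(n + 1 := h))" for h \<nu>
    using ex[OF that] pr[OF that] uniq pr\<mu> by metis
  have opt: "opt ?N h \<mu>" if T: "T_plus_system a b (n + 1) (g(n + 1 := h))" for h
  proof -
    have int: "\<forall>\<nu>\<in>?N. integrable \<nu> h"
      using borel_measures_on_integrable[OF moment_measuresD(1) moment_measures_finite[OF Tn \<open>a < b\<close>] cont[OF T]]
      by blast
    show ?thesis
    proof (cases B)
      case True
      have "is_arg_max (\<lambda>\<rho>. integral\<^sup>L \<rho> h) (\<lambda>\<rho>. \<rho> \<in> ?N) \<nu> \<longleftrightarrow> is_opt h \<nu>" for \<nu>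
        using True by (auto simp: is_arg_max_def is_opt_def not_less)
      with True int iff[OF T] show ?thesis by (simp add: opt_def unique_maximizer_def)
    next
      case False
      have "is_arg_min (\<lambda>\<rho>. integral\<^sup>L \<rho> h) (\<lambda>\<rho>. \<rho> \<in> ?N) \<nu> \<longleftrightarrow> is_opt h \<nu>" for \<nu>
        using False by (auto simp: is_arg_min_def is_opt_def not_less)
      with False int iff[OF T] show ?thesis by (simp add: opt_def unique_minimizer_def)
    qed
  qed
  have \<mu>N: "\<mu> \<in> ?N" using \<mu> by (simp add: is_opt_def)
  let ?F = "(measure_support \<mu> - E) \<union> E"
  have "card ?F \<le> q + card E"
    using card_Un_le[of "measure_support \<mu> - E" E] pr\<mu> by (simp add: principal_def)
  moreover have "finite ?F" "?F \<subseteq> {a..b}"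
    using pr\<mu> E_fin E_sub measure_support_subset[OF moment_measuresD(1)[OF \<mu>N]]
    by (auto simp: principal_def)
  ultimately obtain X where "?F \<subseteq> X" "X \<subseteq> {a..b}" "finite X" "card X = q + card E"
    using ex_superset_card_interval[OF \<open>a < b\<close>] by metis
  with opt \<mu>N show ?thesis
    by (intro that[of \<mu> X]) auto
qed

theorem proposition2:
  fixes a b :: real and n m :: nat
    and g :: "nat \<Rightarrow> real \<Rightarrow> real" and c :: "nat \<Rightarrow> real"
  assumes "a < b"
    and "\<And>i. i \<le> n + 1 \<Longrightarrow> continuous_on {a..b} (g i)"
    and "M_plus_system a b (n + 1) g \<or>
         (T_plus_system a b n g \<and> T_plus_system a b (n + 1) g)"
    and "moment_measures a b n g c \<noteq> {}"
    and "m = (n + 1) div 2"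
  shows "\<exists>\<mu>max \<mu>min.
      unique_maximizer (moment_measures a b n g c) (g (n + 1)) \<mu>max \<and>
      unique_minimizer (moment_measures a b n g c) (g (n + 1)) \<mu>min \<and>
      (\<forall>h. continuous_on {a..b} h \<and> T_plus_system a b (n + 1) (g(n + 1 := h)) \<longrightarrow>
         unique_maximizer (moment_measures a b n g c) h \<mu>max \<and>
         unique_minimizer (moment_measures a b n g c) h \<mu>min) \<and>
      (\<exists>Xmax Xmin. Xmax \<subseteq> {a..b} \<and> Xmin \<subseteq> {a..b} \<and>
         measure_support \<mu>max \<subseteq> Xmax \<and> measure_support \<mu>min \<subseteq> Xmin \<and>
         (n = 2 * m \<longrightarrow> card Xmax = m + 1 \<and> card Xmin = m + 1 \<and> b \<in> Xmax \<and> a \<in> Xmin) \<and>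
         (n + 1 = 2 * m \<longrightarrow> card Xmax = m + 1 \<and> card Xmin = m \<and> {a, b} \<subseteq> Xmax))"
proof -
  let ?N = "moment_measures a b n g c"
  have Tn: "T_plus_system a b n g" and Tn1: "T_plus_system a b (n + 1) g"
    using assms(3) by (auto simp: M_plus_system_def)
  have Th: "T_plus_system a b (n + 1) (g(n + 1 := g (n + 1)))"
    using Tn1 by simp
  let ?Emax = "(if odd n then {a} else {}) \<union> (if True then {b} else {})"
  let ?Emin = "(if even n then {a} else {}) \<union> (if False then {b} else {})"
  have qmax: "n + 1 = 2 * (n div 2) + of_bool (odd n) + of_bool True"
    by (cases "even n") auto
  have qmin: "n + 1 = 2 * ((n + 1) div 2) + of_bool (even n) + of_bool False"
    by (cases "even n") auto
  obtain \<mu>max Xmax where max: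
    "\<And>h. T_plus_system a b (n + 1) (g(n + 1 := h)) \<Longrightarrow>
      (if True then unique_maximizer else unique_minimizer) ?N h \<mu>max"
    "measure_support \<mu>max \<subseteq> Xmax" "Xmax \<subseteq> {a..b}" "?Emax \<subseteq> Xmax" "card Xmax = n div 2 + card ?Emax"
    by (rule principal_measure[OF Tn assms(1,4) Th qmax refl]) blast+
  obtain \<mu>min Xmin where min:
    "\<And>h. T_plus_system a b (n + 1) (g(n + 1 := h)) \<Longrightarrow>
      (if False then unique_maximizer else unique_minimizer) ?N h \<mu>min"
    "measure_support \<mu>min \<subseteq> Xmin" "Xmin \<subseteq> {a..b}" "?Emin \<subseteq> Xmin" "card Xmin = (n + 1) div 2 + card ?Emin"
    by (rule principal_measure[OF Tn assms(1,4) Th qmin refl]) blast+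
  have even_case: "card Xmax = m + 1 \<and> card Xmin = m + 1 \<and> b \<in> Xmax \<and> a \<in> Xmin" if "n = 2 * m"
    using that max(4,5) min(4,5) by simp
  have odd_case: "card Xmax = m + 1 \<and> card Xmin = m \<and> {a, b} \<subseteq> Xmax" if "n + 1 = 2 * m"
  proof -
    have "odd n" "n div 2 + 1 = m" "(n + 1) div 2 = m"
      using that by presburger+
    then show ?thesis
      using max(4,5) min(5) \<open>a < b\<close> by simp
  qed
  show ?thesis
    using max(1-3) min(1-3) max(1)[OF Th] min(1)[OF Th] even_case odd_case
    by (intro exI[of _ \<mu>max] exI[of _ \<mu>min] conjI exI[of _ Xmax] exI[of _ Xmin] allI impI) auto
qed

end
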